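(* Let $F_n$ be the free group of rank $n$, let $\varphi\in\mathrm{Aut}(F_n)$, and for $k\ge1$ let $\overline{G}_k=(F_n^{ab})^{\otimes k}\rtimes_{\overline{\varphi}_k}\mathbb{Z}$ and $\widehat{G}_k=\gamma_k(F_n)/\gamma_{k+1}(F_n)\rtimes_{\widehat{\varphi}_k}\mathbb{Z}$. Let $p$ be a prime. Then for every $k\ge1$: (a) if $\overline{G}_k$ is residually nilpotent, then $\widehat{G}_k$ is residually nilpotent; (b) if $\overline{G}_k$ is residually $p$-finite, then $\widehat{G}_k$ is residually $p$-finite.
   Context: $\gamma_1(F_n)=F_n$, $\gamma_{k+1}(F_n)=[\gamma_k(F_n),F_n]$. $F_n^{ab}=F_n/\gamma_2(F_n)$ is a free $\mathbb{Z}$-module of rank $n$; $\overline{\varphi}$ is the automorphism of $F_n^{ab}$ induced by $\varphi$, and $\overline{\varphi}_k=\overline{\varphi}^{\otimes k}$ is the induced automorphism of the $k$-fold tensor power $(F_n^{ab})^{\otimes k}$ over $\mathbb{Z}$. $\widehat{\varphi}_k$ is the automorphism of the $\mathbb{Z}$-module $\gamma_k(F_n)/\gamma_{k+1}(F_n)$ induced by $\varphi$. For an automorphism $\psi$ of a group $M$, $M\rtimes_\psi\mathbb{Z}$ is the semi-direct product in which a generator $t$ of $\mathbb{Z}$ acts by $t^{-1}mt=\psi(m)$. A group is residually nilpotent (respectively residually $p$-finite) if every non-identity element has non-trivial image under some homomorphism to a nilpotent group (respectively to a finite $p$-group). *)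

theory Defs
  imports
    "HOL-Algebra.Bij"
    "HOL-Algebra.Free_Abelian_Groups"
    "HOL-Computational_Algebra.Primes"
begin

section \<open>Free groups of finite rank\<close>

text \<open>The letter \<open>(i, True)\<close> is the generator \<open>x\<^sub>i\<close> and \<open>(i, False)\<close> is its inverse.
  Elements of the free group are the reduced words; \<open>foldr push u v\<close> is the reduced form
  of the concatenation of the reduced words \<open>u\<close> and \<open>v\<close>.\<close>

type_synonym letter = "nat \<times> bool"

definition inv_letter :: "letter \<Rightarrow> letter"
  where "inv_letter a = (fst a, \<not> snd a)"

definition reduced :: "letter list \<Rightarrow> bool"
  where "reduced = successively (\<lambda>a b. b \<noteq> inv_letter a)"

fun push :: "letter \<Rightarrow> letter list \<Rightarrow> letter list"
  where
    "push a [] = [a]"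
  | "push a (b # w) = (if b = inv_letter a then w else a # b # w)"

definition free_group :: "nat \<Rightarrow> letter list monoid"
  where "free_group n =
    \<lparr>carrier = {w. fst ` set w \<subseteq> {..<n} \<and> reduced w},
     monoid.mult = (\<lambda>u v. foldr push u v),
     one = []\<rparr>"

lemma inv_letter_inv_letter [simp]: "inv_letter (inv_letter a) = a"
  by (simp add: inv_letter_def)

lemma fst_inv_letter [simp]: "fst (inv_letter a) = fst a"
  by (simp add: inv_letter_def)

lemma inv_letter_neq [simp]: "inv_letter a \<noteq> a" "a \<noteq> inv_letter a"
  by (metis inv_letter_def snd_conv)+

lemma reduced_push: "reduced w \<Longrightarrow> reduced (push a w)"
  by (cases w) (auto simp: reduced_def successively_Cons)

lemma push_inv_push: "reduced w \<Longrightarrow> push (inv_letter a) (push a w) = w"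
proof (cases w)
  case (Cons b v)
  assume "reduced w"
  then show ?thesis
    using Cons by (cases v) (auto simp: reduced_def)
qed simp

lemma reduced_foldr_push: "reduced v \<Longrightarrow> reduced (foldr push u v)"
  by (induction u) (auto simp: reduced_push)

lemma foldr_push_push:
  assumes "reduced w"
  shows "foldr push (push a v) w = push a (foldr push v w)"
proof (cases v)
  case (Cons b v')
  then show ?thesis
    using push_inv_push[OF reduced_foldr_push[OF assms], of "inv_letter a" v'] by auto
qed simp

lemma foldr_push_assoc:
  "reduced w \<Longrightarrow> foldr push (foldr push u v) w = foldr push u (foldr push v w)"
  by (induction u) (simp_all add: foldr_push_push)

lemma set_push: "set (push a w) \<subseteq> insert a (set w)"
  by (cases w) auto

lemma set_foldr_push: "set (foldr push u v) \<subseteq> set u \<union> set v"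
  by (induction u) (use set_push in fastforce)+

lemma foldr_push_Nil: "reduced u \<Longrightarrow> foldr push u [] = u"
proof (induction u)
  case (Cons a u)
  then show ?case
    by (cases u) (auto simp: reduced_def)
qed simp

lemma foldr_push_inverse:
  "reduced v \<Longrightarrow> foldr push (map inv_letter (rev u)) (foldr push u v) = v"
  by (induction u arbitrary: v)
    (simp_all add: push_inv_push reduced_foldr_push)

lemma reduced_map_inv_rev: "reduced u \<Longrightarrow> reduced (map inv_letter (rev u))"
  unfolding reduced_def successively_map successively_rev
  by (erule successively_mono) (metis inv_letter_inv_letter)

lemma group_free_group: "group (free_group n)"
proof (rule groupI)
  fix x y assume "x \<in> carrier (free_group n)" "y \<in> carrier (free_group n)"
  then show "x \<otimes>\<^bsub>free_group n\<^esub> y \<in> carrier (free_group n)"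
    using set_foldr_push[of x y] by (auto simp: free_group_def reduced_foldr_push image_subset_iff)
next
  fix x assume x: "x \<in> carrier (free_group n)"
  show "\<exists>y\<in>carrier (free_group n). y \<otimes>\<^bsub>free_group n\<^esub> x = \<one>\<^bsub>free_group n\<^esub>"
  proof
    show "map inv_letter (rev x) \<otimes>\<^bsub>free_group n\<^esub> x = \<one>\<^bsub>free_group n\<^esub>"
      using x foldr_push_inverse[of "[]" x] foldr_push_Nil[of x]
      by (simp add: free_group_def reduced_def)
    show "map inv_letter (rev x) \<in> carrier (free_group n)"
      using x by (auto simp: free_group_def reduced_map_inv_rev image_subset_iff)
  qed
qed (auto simp: free_group_def foldr_push_assoc reduced_def)

definition free_gen :: "nat \<Rightarrow> letter list"
  where "free_gen i = [(i, True)]"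

theorem free_group_universal:
  assumes "group H" and g: "\<And>i. i < n \<Longrightarrow> g i \<in> carrier H"
  shows "\<exists>h \<in> hom (free_group n) H. \<forall>i<n. h (free_gen i) = g i"
proof -
  interpret H: group H by fact
  define ev where "ev = (\<lambda>a::letter. if snd a then g (fst a) else inv\<^bsub>H\<^esub> g (fst a))"
  define h where "h = (\<lambda>w. foldr (\<lambda>a y. ev a \<otimes>\<^bsub>H\<^esub> y) w \<one>\<^bsub>H\<^esub>)"
  have ev [simp]: "ev a \<in> carrier H" if "fst a < n" for a
    using that g by (auto simp: ev_def)
  have ev_inv: "ev (inv_letter a) = inv\<^bsub>H\<^esub> ev a" if "fst a < n" for a
    using that g by (auto simp: ev_def inv_letter_def)
  have h_closed: "h w \<in> carrier H" if "fst ` set w \<subseteq> {..<n}" for w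
    using that by (induction w) (auto simp: h_def)
  have h_Cons: "h (a # w) = ev a \<otimes>\<^bsub>H\<^esub> h w" for a w
    by (simp add: h_def)
  have h_push: "h (push a w) = ev a \<otimes>\<^bsub>H\<^esub> h w" if "fst a < n" "fst ` set w \<subseteq> {..<n}" for a w
    using that by (cases w) (auto simp: h_Cons ev_inv h_closed simp flip: H.m_assoc)
  have h_mult: "h (foldr push u v) = h u \<otimes>\<^bsub>H\<^esub> h v"
    if "fst ` set u \<subseteq> {..<n}" "fst ` set v \<subseteq> {..<n}" for u v
    using that
  proof (induction u)
    case Nil
    then show ?case
      using h_closed by (simp add: h_def)
  next
    case (Cons a u)
    have "fst ` set (foldr push u v) \<subseteq> fst ` (set u \<union> set v)"
      by (rule image_mono[OF set_foldr_push])
    also have "\<dots> \<subseteq> {..<n}"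
      using Cons.prems by auto
    finally have "fst ` set (foldr push u v) \<subseteq> {..<n}" .
    then show ?case
      using Cons by (simp add: h_push h_Cons H.m_assoc h_closed)
  qed
  have "h \<in> hom (free_group n) H"
    by (rule homI) (auto simp: free_group_def h_closed h_mult)
  moreover have "h (free_gen i) = g i" if "i < n" for i
    using that g by (simp add: h_def free_gen_def ev_def)
  ultimately show ?thesis
    by blast
qed

lemma free_group_generated: "generate (free_group n) (free_gen ` {..<n}) = carrier (free_group n)"
proof -
  interpret F: group "free_group n" by (rule group_free_group)
  have gen: "free_gen ` {..<n} \<subseteq> carrier (free_group n)"
    by (auto simp: free_gen_def free_group_def reduced_def)
  have letter: "[a] \<in> generate (free_group n) (free_gen ` {..<n})" if "fst a < n" for a
  proof (cases "snd a")
    case True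
    then have "[a] = free_gen (fst a)"
      by (metis free_gen_def prod.collapse)
    then show ?thesis
      using that by (auto intro: generate.incl)
  next
    case False
    then have a: "a = (fst a, False)"
      by (metis prod.collapse)
    have "inv\<^bsub>free_group n\<^esub> (free_gen (fst a)) = [a]"
      using that a
      by (intro F.inv_equality)
        (auto simp: free_group_def free_gen_def reduced_def inv_letter_def prod_eq_iff)
    then show ?thesis
      using that by (metis generate.inv imageI lessThan_iff)
  qed
  have "w \<in> generate (free_group n) (free_gen ` {..<n})"
    if "fst ` set w \<subseteq> {..<n}" "reduced w" for w
    using that
  proof (induction w)
    case Nil
    then show ?case
      using generate.one[of "free_group n"] by (simp add: free_group_def)
  next
    case (Cons a w)
    then have "reduced w"
      by (auto simp: reduced_def successively_Cons)
    moreover have "a # w = [a] \<otimes>\<^bsub>free_group n\<^esub> w"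
      using foldr_push_Nil[OF Cons.prems(2)] foldr_push_Nil[OF \<open>reduced w\<close>]
      by (simp add: free_group_def)
    ultimately show ?case
      using Cons letter[of a] by (metis (no_types, lifting) generate.eng image_subset_iff
          lessThan_iff list.set_intros)
  qed
  then show ?thesis
    using F.generate_incl[OF gen] by (auto simp: free_group_def)
qed


section \<open>Lower central series\<close>

definition commutator_subgroup :: "('a, 'b) monoid_scheme \<Rightarrow> 'a set \<Rightarrow> 'a set \<Rightarrow> 'a set"
  where "commutator_subgroup G H K = generate G
    (\<Union>h\<in>H. \<Union>k\<in>K. {h \<otimes>\<^bsub>G\<^esub> k \<otimes>\<^bsub>G\<^esub> inv\<^bsub>G\<^esub> h \<otimes>\<^bsub>G\<^esub> inv\<^bsub>G\<^esub> k})"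

text \<open>Indexed from 1, as usual; the value at 0 is a dummy.\<close>

fun lower_central :: "('a, 'b) monoid_scheme \<Rightarrow> nat \<Rightarrow> 'a set"
  where
    "lower_central G 0 = carrier G"
  | "lower_central G (Suc 0) = carrier G"
  | "lower_central G (Suc (Suc k)) = commutator_subgroup G (lower_central G (Suc k)) (carrier G)"

definition abelianization :: "('a, 'b) monoid_scheme \<Rightarrow> 'a set monoid"
  where "abelianization G = G Mod lower_central G 2"

definition lower_central_factor :: "('a, 'b) monoid_scheme \<Rightarrow> nat \<Rightarrow> 'a set monoid"
  where "lower_central_factor G k =
    (G\<lparr>carrier := lower_central G k\<rparr>) Mod lower_central G (Suc k)"

text \<open>The automorphism of \<open>G Mod N\<close> induced by an automorphism \<open>f\<close> of \<open>G\<close> with \<open>f ` N = N\<close>: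
  the coset of \<open>x\<close> is sent to its image under \<open>f\<close>, which is the coset of \<open>f x\<close>.\<close>

definition quotient_map ::
  "('a, 'b) monoid_scheme \<Rightarrow> 'a set \<Rightarrow> ('a \<Rightarrow> 'a) \<Rightarrow> 'a set \<Rightarrow> 'a set"
  where "quotient_map G N f = (\<lambda>C \<in> carrier (G Mod N). f ` C)"

definition abelianization_map ::
  "('a, 'b) monoid_scheme \<Rightarrow> ('a \<Rightarrow> 'a) \<Rightarrow> 'a set \<Rightarrow> 'a set"
  where "abelianization_map G = quotient_map G (lower_central G 2)"

definition lower_central_factor_map ::
  "('a, 'b) monoid_scheme \<Rightarrow> nat \<Rightarrow> ('a \<Rightarrow> 'a) \<Rightarrow> 'a set \<Rightarrow> 'a set"
  where "lower_central_factor_map G k =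
    quotient_map (G\<lparr>carrier := lower_central G k\<rparr>) (lower_central G (Suc k))"

lemma quotient_map_coset:
  assumes "f \<in> iso G G" "N \<lhd> G" "f ` N = N" "x \<in> carrier G"
  shows "quotient_map G N f (N #>\<^bsub>G\<^esub> x) = N #>\<^bsub>G\<^esub> f x"
  using assms coset_hom(2)[of f G G N x] normal_imp_subgroup[OF assms(2)]
  by (auto simp: quotient_map_def carrier_FactGroup iso_def subgroup.subset)

lemma quotient_map_auto:
  assumes f: "f \<in> iso G G" and N: "N \<lhd> G" and fN: "f ` N = N"
  shows "quotient_map G N f \<in> auto (G Mod N)"
proof -
  interpret N: normal N G by fact
  note qm = quotient_map_coset[OF assms]
  have f_closed: "f x \<in> carrier G" if "x \<in> carrier G" for x
    using f that by (auto simp: iso_def hom_def)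
  have f_mult: "f (x \<otimes>\<^bsub>G\<^esub> y) = f x \<otimes>\<^bsub>G\<^esub> f y" if "x \<in> carrier G" "y \<in> carrier G" for x y
    using f that by (auto simp: iso_def hom_def)
  have f_surj: "f ` carrier G = carrier G"
    using f by (auto simp: iso_def bij_betw_def)
  have f_inj: "inj_on f (carrier G)"
    using f by (auto simp: iso_def bij_betw_def)
  have "quotient_map G N f \<in> hom (G Mod N) (G Mod N)"
    by (rule homI)
      (auto simp: carrier_FactGroup qm f_closed f_mult N.rcos_sum)
  moreover have "inj_on (quotient_map G N f) (carrier (G Mod N))"
  proof (rule inj_onI)
    fix C D assume CD: "C \<in> carrier (G Mod N)" "D \<in> carrier (G Mod N)"
      "quotient_map G N f C = quotient_map G N f D"
    then have "C \<subseteq> carrier G" "D \<subseteq> carrier G"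
      using N.r_coset_subset_G[OF N.subset] by (auto simp: carrier_FactGroup)
    moreover have "f ` C = f ` D"
      using CD by (simp add: quotient_map_def)
    ultimately show "C = D"
      using f_inj by (meson inj_on_image_eq_iff)
  qed
  moreover have "quotient_map G N f ` carrier (G Mod N) = carrier (G Mod N)"
  proof -
    have "quotient_map G N f ` carrier (G Mod N) = (\<lambda>x. N #>\<^bsub>G\<^esub> f x) ` carrier G"
      unfolding carrier_FactGroup image_image by (rule image_cong) (simp_all add: qm)
    also have "\<dots> = (\<lambda>x. N #>\<^bsub>G\<^esub> x) ` (f ` carrier G)"
      by (simp add: image_image)
    finally show ?thesis
      by (simp add: f_surj carrier_FactGroup)
  qed
  ultimately show ?thesis
    by (auto simp: auto_def Bij_def bij_betw_def quotient_map_def)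
qed

lemma (in group) lower_central_normal: "lower_central G k \<lhd> G"
proof (induction k rule: lower_central.induct[of "\<lambda>_ k. lower_central G k \<lhd> G" G, case_names z o s])
  case (s _ k)
  then interpret N: normal "lower_central G (Suc k)" G
    by simp
  show ?case
    unfolding lower_central.simps commutator_subgroup_def
  proof (rule normal_generateI, goal_cases)
    case 1
    then show ?case
      using N.subset by auto
  next
    case (2 c g)
    then obtain h k' where hk: "h \<in> lower_central G (Suc k)" "k' \<in> carrier G"
      "c = h \<otimes> k' \<otimes> inv h \<otimes> inv k'"
      by blast
    note h = subsetD[OF N.subset hk(1)]
    have "g \<otimes> c \<otimes> inv g = (g \<otimes> h \<otimes> inv g) \<otimes> (g \<otimes> k' \<otimes> inv g)
        \<otimes> inv (g \<otimes> h \<otimes> inv g) \<otimes> inv (g \<otimes> k' \<otimes> inv g)"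
    proof -
      have conj_mult: "(g \<otimes> a \<otimes> inv g) \<otimes> (g \<otimes> b \<otimes> inv g) = g \<otimes> (a \<otimes> b) \<otimes> inv g"
        if "a \<in> carrier G" "b \<in> carrier G" for a b
      proof -
        have "inv g \<otimes> (g \<otimes> (b \<otimes> inv g)) = b \<otimes> inv g"
          using that 2 by (simp flip: m_assoc)
        then show ?thesis
          using that 2 by (simp add: m_assoc)
      qed
      have conj_inv: "inv (g \<otimes> a \<otimes> inv g) = g \<otimes> inv a \<otimes> inv g" if "a \<in> carrier G" for a
        using that 2 by (simp add: inv_mult_group m_assoc)
      show ?thesis
        using h hk 2 by (simp only: conj_mult conj_inv m_closed inv_closed)
    qed
    moreover have "g \<otimes> h \<otimes> inv g \<in> lower_central G (Suc k)" "g \<otimes> k' \<otimes> inv g \<in> carrier G"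
      using N.inv_op_closed2 hk 2 by auto
    ultimately show ?case
      by blast
  qed
qed (simp_all add: normal_self)

lemma (in group) lower_central_subset: "lower_central G k \<subseteq> carrier G"
  using lower_central_normal normal_imp_subgroup subgroup.subset by blast

lemma (in group) lower_central_Suc_subset: "lower_central G (Suc k) \<subseteq> lower_central G k"
proof (cases k)
  case (Suc j)
  interpret N: normal "lower_central G (Suc j)" G
    by (rule lower_central_normal)
  have "h \<otimes> x \<otimes> inv h \<otimes> inv x \<in> lower_central G (Suc j)"
    if hx: "h \<in> lower_central G (Suc j)" "x \<in> carrier G" for h x
  proof -
    have "h \<otimes> (x \<otimes> inv h \<otimes> inv x) \<in> lower_central G (Suc j)"
      using hx N.inv_op_closed2 by auto
    then show ?thesis
      using hx subsetD[OF N.subset hx(1)] by (simp add: m_assoc)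
  qed
  then have "commutator_subgroup G (lower_central G (Suc j)) (carrier G) \<subseteq> lower_central G (Suc j)"
    unfolding commutator_subgroup_def
    by (intro generate_subgroup_incl[OF _ N.subgroup_axioms]) blast
  then show ?thesis
    by (simp add: Suc)
qed simp

lemma (in group_hom) lower_central_image:
  "h ` lower_central G k \<subseteq> lower_central H k"
  "h ` carrier G = carrier H \<Longrightarrow> h ` lower_central G k = lower_central H k"
proof -
  have img: "h ` lower_central G (Suc (Suc k)) =
      generate H (\<Union>x \<in> h ` lower_central G (Suc k). \<Union>y \<in> h ` carrier G.
        {x \<otimes>\<^bsub>H\<^esub> y \<otimes>\<^bsub>H\<^esub> inv\<^bsub>H\<^esub> x \<otimes>\<^bsub>H\<^esub> inv\<^bsub>H\<^esub> y})" for k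
  proof -
    have sub: "x \<in> carrier G" if "x \<in> lower_central G (Suc k)" for x
      using that G.lower_central_subset by blast
    let ?C = "\<Union>x\<in>lower_central G (Suc k). \<Union>y\<in>carrier G. {x \<otimes> y \<otimes> inv x \<otimes> inv y}"
    have "?C \<subseteq> carrier G"
      using sub by auto
    moreover have "h ` ?C = (\<Union>x \<in> h ` lower_central G (Suc k). \<Union>y \<in> h ` carrier G.
        {x \<otimes>\<^bsub>H\<^esub> y \<otimes>\<^bsub>H\<^esub> inv\<^bsub>H\<^esub> x \<otimes>\<^bsub>H\<^esub> inv\<^bsub>H\<^esub> y})"
      using sub by (simp add: image_UN)
    ultimately show ?thesis
      using generate_img[of ?C] unfolding lower_central.simps(3)[of G] commutator_subgroup_def
      by (simp only:)
  qed
  have carr: "h ` carrier G \<subseteq> carrier H"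
    by auto
  show "h ` lower_central G k \<subseteq> lower_central H k"
  proof (induction k rule: lower_central.induct[of "\<lambda>_ k. h ` lower_central G k \<subseteq> lower_central H k" G, case_names z o s])
    case (s _ k)
    show ?case
      unfolding img lower_central.simps(3)[of H] commutator_subgroup_def
      by (rule H.mono_generate, rule UN_mono[OF s UN_mono[OF carr]]) simp
  qed auto
  show "h ` lower_central G k = lower_central H k" if "h ` carrier G = carrier H"
  proof (induction k rule: lower_central.induct[of "\<lambda>_ k. h ` lower_central G k = lower_central H k" G, case_names z o s])
    case (s _ k)
    then show ?case
      unfolding img lower_central.simps(3)[of H] commutator_subgroup_def by (simp add: that)
  qed (simp_all add: that)
qed

lemma (in group) iso_lower_central:
  assumes "f \<in> iso G G"
  shows "f ` lower_central G k = lower_central G k"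
proof -
  interpret group_hom G G f
    using assms by unfold_locales (simp add: iso_def)
  show ?thesis
    using assms by (intro lower_central_image(2)) (simp add: iso_def bij_betw_def)
qed

lemma (in group) lower_central_Suc_normal:
  "lower_central G (Suc k) \<lhd> G\<lparr>carrier := lower_central G k\<rparr>"
  using normal_restrict_supergroup[OF normal_imp_subgroup[OF lower_central_normal]
      lower_central_normal lower_central_Suc_subset] .

lemma (in group) abelianization_map_auto:
  "f \<in> auto G \<Longrightarrow> abelianization_map G f \<in> auto (abelianization G)"
  unfolding abelianization_map_def abelianization_def
  by (rule quotient_map_auto)
    (auto simp: auto_def Bij_def iso_def lower_central_normal intro!: iso_lower_central)

lemma (in group) lower_central_factor_map_auto:
  assumes "f \<in> auto G"
  shows "lower_central_factor_map G k f \<in> auto (lower_central_factor G k)"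
proof -
  have f: "f \<in> iso G G"
    using assms by (auto simp: auto_def Bij_def iso_def)
  have "f \<in> iso (G\<lparr>carrier := lower_central G k\<rparr>) (G\<lparr>carrier := lower_central G k\<rparr>)"
    using f lower_central_subset[of k] iso_lower_central[OF f, of k]
    by (auto simp: iso_def hom_def bij_betw_def subset_iff intro: inj_on_subset)
  then show ?thesis
    unfolding lower_central_factor_map_def lower_central_factor_def
    using lower_central_Suc_normal iso_lower_central[OF f] by (rule quotient_map_auto)
qed


section \<open>Tensor powers of abelian groups over the integers\<close>

text \<open>The tensor power is the free abelian group on the \<open>k\<close>-tuples modulo additivity in each
  argument; compatibility with integer scalars is a consequence of additivity.\<close>

definition tensor_tuples :: "('a, 'b) monoid_scheme \<Rightarrow> nat \<Rightarrow> 'a list set"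
  where "tensor_tuples A k = {xs. length xs = k \<and> set xs \<subseteq> carrier A}"

definition tensor_relators :: "('a, 'b) monoid_scheme \<Rightarrow> nat \<Rightarrow> ('a list \<Rightarrow>\<^sub>0 int) set"
  where "tensor_relators A k =
    {frag_of (us @ (x \<otimes>\<^bsub>A\<^esub> y) # vs) - frag_of (us @ x # vs) - frag_of (us @ y # vs) | us x y vs.
       us @ x # vs \<in> tensor_tuples A k \<and> y \<in> carrier A}"

definition tensor_relations :: "('a, 'b) monoid_scheme \<Rightarrow> nat \<Rightarrow> ('a list \<Rightarrow>\<^sub>0 int) set"
  where "tensor_relations A k =
    generate (free_Abelian_group (tensor_tuples A k)) (tensor_relators A k)"

definition tensor_power :: "('a, 'b) monoid_scheme \<Rightarrow> nat \<Rightarrow> ('a list \<Rightarrow>\<^sub>0 int) set monoid"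
  where "tensor_power A k = free_Abelian_group (tensor_tuples A k) Mod tensor_relations A k"

definition pure_tensor :: "('a, 'b) monoid_scheme \<Rightarrow> nat \<Rightarrow> 'a list \<Rightarrow> ('a list \<Rightarrow>\<^sub>0 int) set"
  where "pure_tensor A k xs =
    tensor_relations A k #>\<^bsub>free_Abelian_group (tensor_tuples A k)\<^esub> frag_of xs"

text \<open>The \<open>k\<close>-fold tensor power of an automorphism \<open>f\<close> of \<open>A\<close>.\<close>

definition tensor_power_map ::
  "('a, 'b) monoid_scheme \<Rightarrow> nat \<Rightarrow> ('a \<Rightarrow> 'a) \<Rightarrow> ('a list \<Rightarrow>\<^sub>0 int) set \<Rightarrow> ('a list \<Rightarrow>\<^sub>0 int) set"
  where "tensor_power_map A k f =
    quotient_map (free_Abelian_group (tensor_tuples A k)) (tensor_relations A k)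
      (frag_extend (\<lambda>xs. frag_of (map f xs)))"

lemma tensor_relators_subset:
  assumes "group A"
  shows "tensor_relators A k \<subseteq> carrier (free_Abelian_group (tensor_tuples A k))"
proof -
  interpret A: group A by fact
  show ?thesis
    unfolding tensor_relators_def
  proof clarify
    fix us x y vs
    assume *: "us @ x # vs \<in> tensor_tuples A k" "y \<in> carrier A"
    let ?a = "frag_of (us @ (x \<otimes>\<^bsub>A\<^esub> y) # vs)" and ?b = "frag_of (us @ x # vs)"
      and ?c = "frag_of (us @ y # vs)"
    have "Poly_Mapping.keys (?a - ?b - ?c) \<subseteq>
        Poly_Mapping.keys ?a \<union> Poly_Mapping.keys ?b \<union> Poly_Mapping.keys ?c"
      using keys_diff[of "?a - ?b" ?c] keys_diff[of ?a ?b] by blast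
    also have "\<dots> \<subseteq> tensor_tuples A k"
      using * by (auto simp: tensor_tuples_def)
    finally show "?a - ?b - ?c \<in> carrier (free_Abelian_group (tensor_tuples A k))"
      by simp
  qed
qed

lemma tensor_relations_normal:
  assumes "group A"
  shows "tensor_relations A k \<lhd> free_Abelian_group (tensor_tuples A k)"
proof -
  interpret T: comm_group "free_Abelian_group (tensor_tuples A k)"
    by (rule abelian_free_Abelian_group)
  show ?thesis
    unfolding tensor_relations_def T.normal_iff_subgroup
    by (rule T.generate_is_subgroup[OF tensor_relators_subset[OF assms]])
qed

lemma comm_group_tensor_power:
  assumes "group A"
  shows "comm_group (tensor_power A k)"
  unfolding tensor_power_def
  by (rule comm_group.abelian_FactGroup[OF abelian_free_Abelian_group])
    (rule normal_imp_subgroup[OF tensor_relations_normal[OF assms]])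

lemma pure_tensor_mult:
  assumes "group A" and T: "us @ x # vs \<in> tensor_tuples A k" "y \<in> carrier A"
  shows "pure_tensor A k (us @ (x \<otimes>\<^bsub>A\<^esub> y) # vs) =
    pure_tensor A k (us @ x # vs) \<otimes>\<^bsub>tensor_power A k\<^esub> pure_tensor A k (us @ y # vs)"
proof -
  interpret A: group A by fact
  interpret R: normal "tensor_relations A k" "free_Abelian_group (tensor_tuples A k)"
    by (rule tensor_relations_normal[OF assms(1)])
  have T': "us @ y # vs \<in> tensor_tuples A k" "us @ (x \<otimes>\<^bsub>A\<^esub> y) # vs \<in> tensor_tuples A k"
    using T by (auto simp: tensor_tuples_def)
  have "frag_of (us @ (x \<otimes>\<^bsub>A\<^esub> y) # vs) - frag_of (us @ x # vs) - frag_of (us @ y # vs)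
      \<in> tensor_relations A k" (is "?r \<in> _")
    unfolding tensor_relations_def tensor_relators_def using T by (blast intro: generate.incl)
  moreover have "frag_of (us @ (x \<otimes>\<^bsub>A\<^esub> y) # vs) =
      ?r \<otimes>\<^bsub>free_Abelian_group (tensor_tuples A k)\<^esub> (frag_of (us @ x # vs) + frag_of (us @ y # vs))"
    by simp
  moreover have sum: "frag_of (us @ x # vs) + frag_of (us @ y # vs)
      \<in> carrier (free_Abelian_group (tensor_tuples A k))"
    using keys_add[of "frag_of (us @ x # vs)" "frag_of (us @ y # vs)"] T(1) T'(1)
    by (auto simp: carrier_free_Abelian_group_iff)
  ultimately have "pure_tensor A k (us @ (x \<otimes>\<^bsub>A\<^esub> y) # vs) =
      tensor_relations A k #>\<^bsub>free_Abelian_group (tensor_tuples A k)\<^esub>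
        (frag_of (us @ x # vs) \<otimes>\<^bsub>free_Abelian_group (tensor_tuples A k)\<^esub> frag_of (us @ y # vs))"
    unfolding pure_tensor_def
    by (intro R.repr_independence[OF _ _ R.subgroup_axioms, symmetric])
      (force simp: r_coset_def simp del: carrier_free_Abelian_group_iff)+
  also have "\<dots> = pure_tensor A k (us @ x # vs) \<otimes>\<^bsub>tensor_power A k\<^esub> pure_tensor A k (us @ y # vs)"
    unfolding pure_tensor_def tensor_power_def mult_FactGroup
    by (rule R.rcos_sum[symmetric]) (simp_all add: T T')
  finally show ?thesis .
qed

theorem tensor_power_universal:
  assumes "group A" "comm_group B" and m: "m ` tensor_tuples A k \<subseteq> carrier B"
    and additive: "\<And>us x y vs. us @ x # vs \<in> tensor_tuples A k \<Longrightarrow> y \<in> carrier A \<Longrightarrow>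
      m (us @ (x \<otimes>\<^bsub>A\<^esub> y) # vs) = m (us @ x # vs) \<otimes>\<^bsub>B\<^esub> m (us @ y # vs)"
  shows "\<exists>h \<in> hom (tensor_power A k) B. \<forall>xs \<in> tensor_tuples A k. h (pure_tensor A k xs) = m xs"
proof -
  interpret A: group A by fact
  interpret B: comm_group B by fact
  let ?T = "free_Abelian_group (tensor_tuples A k)"
  obtain g where g: "g \<in> hom ?T B" "\<And>xs. xs \<in> tensor_tuples A k \<Longrightarrow> g (frag_of xs) = m xs"
    using B.free_Abelian_group_universal[OF m] by blast
  interpret g: group_hom ?T B g
    using g(1) by (simp add: group_hom_def group_hom_axioms_def B.group_axioms)
  have diff: "g (a - b) = g a \<otimes>\<^bsub>B\<^esub> inv\<^bsub>B\<^esub> g b" if "a \<in> carrier ?T" "b \<in> carrier ?T" for a b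
    using g.hom_mult[of a "- b"] g.hom_inv[OF that(2)] that by simp
  have "tensor_relators A k \<subseteq> kernel ?T B g"
  proof
    fix r assume r: "r \<in> tensor_relators A k"
    then obtain us x y vs where xy: "us @ x # vs \<in> tensor_tuples A k" "y \<in> carrier A"
      and r_eq: "r = frag_of (us @ (x \<otimes>\<^bsub>A\<^esub> y) # vs) - frag_of (us @ x # vs) - frag_of (us @ y # vs)"
      unfolding tensor_relators_def by blast
    have T: "us @ y # vs \<in> tensor_tuples A k" "us @ (x \<otimes>\<^bsub>A\<^esub> y) # vs \<in> tensor_tuples A k"
      using xy by (auto simp: tensor_tuples_def)
    have mB: "m xs \<in> carrier B" if "xs \<in> tensor_tuples A k" for xs
      using m that by blast
    have d: "frag_of (us @ (x \<otimes>\<^bsub>A\<^esub> y) # vs) - frag_of (us @ x # vs) \<in> carrier ?T"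
      using keys_diff[of "frag_of (us @ (x \<otimes>\<^bsub>A\<^esub> y) # vs)" "frag_of (us @ x # vs)"] xy T by auto
    have "g r = m (us @ x # vs) \<otimes>\<^bsub>B\<^esub> m (us @ y # vs) \<otimes>\<^bsub>B\<^esub> inv\<^bsub>B\<^esub> m (us @ x # vs) \<otimes>\<^bsub>B\<^esub> inv\<^bsub>B\<^esub> m (us @ y # vs)"
      unfolding r_eq using d xy T by (simp add: diff g(2) additive[OF xy])
    also have "\<dots> = \<one>\<^bsub>B\<^esub>"
      using mB[OF xy(1)] mB[OF T(1)]
      by (metis B.inv_mult B.m_assoc B.inv_closed B.m_closed B.r_inv)
    finally show "r \<in> kernel ?T B g"
      using r tensor_relators_subset[OF assms(1)] unfolding kernel_def by blast
  qed
  then have "tensor_relations A k \<subseteq> kernel ?T B g"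
    unfolding tensor_relations_def
    by (rule g.G.generate_subgroup_incl[OF _ g.subgroup_kernel])
  then obtain h where "h \<in> hom (?T Mod tensor_relations A k) B"
    "\<And>x. x \<in> carrier ?T \<Longrightarrow> h (tensor_relations A k #>\<^bsub>?T\<^esub> x) = g x"
    using g.FactGroup_universal_kernel[OF tensor_relations_normal[OF assms(1)]] by blast
  then show ?thesis
    unfolding tensor_power_def pure_tensor_def using g(2) by (intro bexI[of _ h]) auto
qed

lemma map_tensor_tuples:
  "f \<in> hom A A \<Longrightarrow> xs \<in> tensor_tuples A k \<Longrightarrow> map f xs \<in> tensor_tuples A k"
  by (auto simp: tensor_tuples_def hom_def Pi_iff)

lemma frag_extend_map_closed:
  assumes "f \<in> hom A A" "c \<in> carrier (free_Abelian_group (tensor_tuples A k))"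
  shows "frag_extend (\<lambda>xs. frag_of (map f xs)) c \<in> carrier (free_Abelian_group (tensor_tuples A k))"
proof -
  have "Poly_Mapping.keys (frag_extend (\<lambda>xs. frag_of (map f xs)) c) \<subseteq> map f ` Poly_Mapping.keys c"
    using keys_frag_extend[of "\<lambda>xs. frag_of (map f xs)" c] by auto
  also have "\<dots> \<subseteq> tensor_tuples A k"
    using assms(2) map_tensor_tuples[OF assms(1)] by auto
  finally show ?thesis
    by simp
qed

lemma frag_extend_map_relators:
  assumes "f \<in> hom A A"
  shows "frag_extend (\<lambda>xs. frag_of (map f xs)) ` tensor_relators A k \<subseteq> tensor_relators A k"
proof clarify
  fix r assume "r \<in> tensor_relators A k"
  then obtain us x y vs where xy: "us @ x # vs \<in> tensor_tuples A k" "y \<in> carrier A"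
    and r: "r = frag_of (us @ (x \<otimes>\<^bsub>A\<^esub> y) # vs) - frag_of (us @ x # vs) - frag_of (us @ y # vs)"
    unfolding tensor_relators_def by blast
  have "x \<in> carrier A"
    using xy(1) by (simp add: tensor_tuples_def)
  then have "f (x \<otimes>\<^bsub>A\<^esub> y) = f x \<otimes>\<^bsub>A\<^esub> f y"
    by (rule hom_mult[OF assms _ xy(2)])
  then have "frag_extend (\<lambda>xs. frag_of (map f xs)) r =
      frag_of (map f us @ (f x \<otimes>\<^bsub>A\<^esub> f y) # map f vs)
      - frag_of (map f us @ f x # map f vs) - frag_of (map f us @ f y # map f vs)"
    by (simp add: r frag_extend_diff)
  moreover have "map f us @ f x # map f vs \<in> tensor_tuples A k" "f y \<in> carrier A"
    using map_tensor_tuples[OF assms xy(1)] hom_in_carrier[OF assms xy(2)] by simp_all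
  ultimately show "frag_extend (\<lambda>xs. frag_of (map f xs)) r \<in> tensor_relators A k"
    unfolding tensor_relators_def by blast
qed

lemma frag_extend_map_inverse:
  assumes "\<And>x. x \<in> carrier A \<Longrightarrow> g (f x) = x" "c \<in> carrier (free_Abelian_group (tensor_tuples A k))"
  shows "frag_extend (\<lambda>xs. frag_of (map g xs)) (frag_extend (\<lambda>xs. frag_of (map f xs)) c) = c"
proof -
  have "frag_extend (\<lambda>xs. frag_of (map g xs)) (frag_extend (\<lambda>xs. frag_of (map f xs)) c) =
      frag_extend (\<lambda>xs. frag_of (map g (map f xs))) c"
    using frag_extend_compose[of "\<lambda>xs. frag_of (map g xs)" "map f" c] by (simp add: o_def)
  also have "\<dots> = frag_extend frag_of c"
  proof (rule frag_extend_eq)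
    fix xs assume "xs \<in> Poly_Mapping.keys c"
    then have "set xs \<subseteq> carrier A"
      using assms(2) by (auto simp: tensor_tuples_def)
    then have "map g (map f xs) = xs"
      using assms(1) by (simp add: map_idI subset_iff)
    then show "frag_of (map g (map f xs)) = frag_of xs"
      by (simp only:)
  qed
  finally show ?thesis
    by (simp flip: frag_expansion)
qed

lemma frag_extend_map_iso:
  fixes A :: "('a, 'b) monoid_scheme" and k :: nat
  assumes "group A" "f \<in> iso A A"
  defines "T \<equiv> free_Abelian_group (tensor_tuples A k)"
    and "F \<equiv> frag_extend (\<lambda>xs. frag_of (map f xs))"
  shows "F \<in> iso T T" "F ` tensor_relations A k = tensor_relations A k"
proof -
  interpret A: group A by fact
  define g where "g = inv_into (carrier A) f"
  define F' where "F' = frag_extend (\<lambda>xs. frag_of (map g xs))"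
  have f: "f \<in> hom A A" and fg: "bij_betw f (carrier A) (carrier A)"
    using assms(2) by (auto simp: iso_def)
  have g: "g \<in> hom A A"
    using A.iso_set_sym[OF assms(2)] by (auto simp: g_def iso_def)
  have gf: "g (f x) = x" "f (g x) = x" if "x \<in> carrier A" for x
    using that fg by (simp_all add: g_def bij_betw_inv_into_left bij_betw_inv_into_right)
  have inv: "F' (F c) = c" "F (F' c) = c" if "c \<in> carrier T" for c
    using that frag_extend_map_inverse[of A g f c k] frag_extend_map_inverse[of A f g c k] gf
    by (simp_all add: T_def F_def F'_def)
  have closed: "F c \<in> carrier T" "F' c \<in> carrier T" if "c \<in> carrier T" for c
    using that frag_extend_map_closed[OF f] frag_extend_map_closed[OF g]
    unfolding T_def F_def F'_def by blast+
  have hom: "F \<in> hom T T"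
    using closed by (intro homI) (simp_all add: T_def F_def frag_extend_add)
  show "F \<in> iso T T"
    using hom by (simp add: iso_def bij_betw_byWitness[where f' = F'] inv closed image_subset_iff)
  have "tensor_relators A k = F ` F' ` tensor_relators A k"
    using tensor_relators_subset[OF assms(1), of k] inv unfolding image_image
    by (auto simp: T_def subset_iff simp del: carrier_free_Abelian_group_iff)
  also have "\<dots> \<subseteq> F ` tensor_relators A k"
    unfolding F'_def by (intro image_mono frag_extend_map_relators g)
  finally have "F ` tensor_relators A k = tensor_relators A k"
    using frag_extend_map_relators[OF f] unfolding F_def by blast
  moreover interpret F: group_hom T T F
    using hom by (simp add: group_hom_def group_hom_axioms_def T_def)
  have "generate T (F ` tensor_relators A k) = F ` generate T (tensor_relators A k)"
    using tensor_relators_subset[OF assms(1)] by (intro F.generate_img) (simp add: T_def)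
  ultimately show "F ` tensor_relations A k = tensor_relations A k"
    by (simp add: tensor_relations_def T_def)
qed

lemma tensor_power_map_auto:
  assumes "group A" "f \<in> iso A A"
  shows "tensor_power_map A k f \<in> auto (tensor_power A k)"
  unfolding tensor_power_map_def tensor_power_def
  by (intro quotient_map_auto frag_extend_map_iso tensor_relations_normal assms)

lemma tensor_power_map_pure_tensor:
  assumes "group A" "f \<in> iso A A" "xs \<in> tensor_tuples A k"
  shows "tensor_power_map A k f (pure_tensor A k xs) = pure_tensor A k (map f xs)"
  unfolding tensor_power_map_def pure_tensor_def
  by (subst quotient_map_coset)
    (simp_all add: frag_extend_map_iso tensor_relations_normal assms)


section \<open>Semidirect products with the integers\<close>

text \<open>The pair \<open>(a, i)\<close> stands for \<open>t\<^sup>i a\<close>, where \<open>t\<close> generates the integers. As \<open>t\<close> acts by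
  \<open>t\<^sup>-\<^sup>1 a t = \<psi> a\<close>, we have \<open>t\<^sup>i a t\<^sup>j b = t\<^sup>i\<^sup>+\<^sup>j (\<psi>\<^sup>j a) b\<close>.\<close>

definition semidirect_int :: "('a, 'b) monoid_scheme \<Rightarrow> ('a \<Rightarrow> 'a) \<Rightarrow> ('a \<times> int) monoid"
  where "semidirect_int M \<psi> =
    \<lparr>carrier = carrier M \<times> UNIV,
     monoid.mult = (\<lambda>(a, i) (b, j). ((\<psi> [^]\<^bsub>AutoGroup M\<^esub> j) a \<otimes>\<^bsub>M\<^esub> b, i + j)),
     one = (\<one>\<^bsub>M\<^esub>, 0)\<rparr>"

lemma group_semidirect_int:
  assumes "group M" "\<psi> \<in> auto M"
  shows "group (semidirect_int M \<psi>)"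
proof -
  interpret M: group M by fact
  interpret Aut: group "AutoGroup M" by (rule M.AutoGroup)
  define act where "act = (\<lambda>j::int. \<psi> [^]\<^bsub>AutoGroup M\<^esub> j)"
  have carr: "carrier (AutoGroup M) = auto M"
    by (simp add: AutoGroup_def)
  have auto: "act j \<in> auto M" for j
    using Aut.int_pow_closed[of \<psi> j] assms(2) by (simp add: act_def carr)
  then have act_closed [simp]: "act j a \<in> carrier M" if "a \<in> carrier M" for j a
    using that by (auto simp: auto_def hom_def)
  have act_mult: "act j (a \<otimes>\<^bsub>M\<^esub> b) = act j a \<otimes>\<^bsub>M\<^esub> act j b"
    if "a \<in> carrier M" "b \<in> carrier M" for j a b
    using auto[of j] that by (auto simp: auto_def hom_def)
  have act_one [simp]: "act j \<one>\<^bsub>M\<^esub> = \<one>\<^bsub>M\<^esub>" for j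
    using auto[of j] hom_one M.group_axioms by (auto simp: auto_def)
  have act_0 [simp]: "act 0 a = a" if "a \<in> carrier M" for a
    using that by (simp add: act_def AutoGroup_def BijGroup_def)
  have act_add: "act (i + j) a = act i (act j a)" if "a \<in> carrier M" for i j a
  proof -
    have "act (i + j) = act i \<otimes>\<^bsub>AutoGroup M\<^esub> act j"
      unfolding act_def using assms(2) by (intro Aut.int_pow_mult) (simp add: carr)
    then show ?thesis
      using that auto[of i] auto[of j] by (simp add: AutoGroup_def BijGroup_def auto_def compose_def)
  qed
  have mult: "(a, i) \<otimes>\<^bsub>semidirect_int M \<psi>\<^esub> (b, j) = (act j a \<otimes>\<^bsub>M\<^esub> b, i + j)" for a b i j
    by (simp add: semidirect_int_def act_def)
  have carrier: "x \<in> carrier (semidirect_int M \<psi>) \<longleftrightarrow> fst x \<in> carrier M" for x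
    by (cases x) (simp add: semidirect_int_def)
  have one: "\<one>\<^bsub>semidirect_int M \<psi>\<^esub> = (\<one>\<^bsub>M\<^esub>, 0)"
    by (simp add: semidirect_int_def)
  show ?thesis
  proof (rule groupI)
    fix x y z
    assume "x \<in> carrier (semidirect_int M \<psi>)" "y \<in> carrier (semidirect_int M \<psi>)"
      "z \<in> carrier (semidirect_int M \<psi>)"
    then show "x \<otimes>\<^bsub>semidirect_int M \<psi>\<^esub> y \<otimes>\<^bsub>semidirect_int M \<psi>\<^esub> z =
        x \<otimes>\<^bsub>semidirect_int M \<psi>\<^esub> (y \<otimes>\<^bsub>semidirect_int M \<psi>\<^esub> z)"
      by (cases x; cases y; cases z)
        (simp add: carrier mult act_mult M.m_assoc flip: act_add, simp add: add.commute)
  next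
    fix x assume "x \<in> carrier (semidirect_int M \<psi>)"
    then obtain a i where x: "x = (a, i)" "a \<in> carrier M"
      by (cases x) (auto simp: carrier)
    show "\<exists>y\<in>carrier (semidirect_int M \<psi>). y \<otimes>\<^bsub>semidirect_int M \<psi>\<^esub> x = \<one>\<^bsub>semidirect_int M \<psi>\<^esub>"
      using x by (intro bexI[of _ "(act (- i) (inv\<^bsub>M\<^esub> a), - i)"])
        (simp_all add: carrier mult one flip: act_add)
  qed (auto simp: carrier mult one)
qed

lemma semidirect_int_conj:
  assumes "group M" "\<psi> \<in> auto M" "a \<in> carrier M"
  shows "inv\<^bsub>semidirect_int M \<psi>\<^esub> (\<one>\<^bsub>M\<^esub>, 1) \<otimes>\<^bsub>semidirect_int M \<psi>\<^esub> (a, 0)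
    \<otimes>\<^bsub>semidirect_int M \<psi>\<^esub> (\<one>\<^bsub>M\<^esub>, 1) = (\<psi> a, 0)"
proof -
  interpret M: group M by fact
  interpret S: group "semidirect_int M \<psi>" by (rule group_semidirect_int[OF assms(1,2)])
  interpret Aut: group "AutoGroup M" by (rule M.AutoGroup)
  have \<psi>: "\<psi> \<in> carrier (AutoGroup M)"
    using assms(2) by (simp add: AutoGroup_def)
  have \<psi>_closed: "\<psi> x \<in> carrier M" if "x \<in> carrier M" for x
    using assms(2) that by (auto simp: auto_def hom_def)
  have "\<psi> \<one>\<^bsub>M\<^esub> = \<one>\<^bsub>M\<^esub>"
    using assms(2) hom_one M.group_axioms by (auto simp: auto_def)
  moreover have "\<one>\<^bsub>AutoGroup M\<^esub> x = x" if "x \<in> carrier M" for x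
    using that by (simp add: AutoGroup_def BijGroup_def)
  ultimately show ?thesis
    using assms(3) \<psi>_closed[OF assms(3)] Aut.int_pow_1[OF \<psi>]
      S.inv_equality[of "(\<one>\<^bsub>M\<^esub>, -1)" "(\<one>\<^bsub>M\<^esub>, 1)"]
    by (simp add: semidirect_int_def)
qed

definition G_bar ::
  "('a, 'b) monoid_scheme \<Rightarrow> ('a \<Rightarrow> 'a) \<Rightarrow> nat \<Rightarrow> (('a set list \<Rightarrow>\<^sub>0 int) set \<times> int) monoid"
  where "G_bar F \<phi> k =
    semidirect_int (tensor_power (abelianization F) k)
      (tensor_power_map (abelianization F) k (abelianization_map F \<phi>))"

definition G_hat ::
  "('a, 'b) monoid_scheme \<Rightarrow> ('a \<Rightarrow> 'a) \<Rightarrow> nat \<Rightarrow> ('a set \<times> int) monoid"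
  where "G_hat F \<phi> k =
    semidirect_int (lower_central_factor F k) (lower_central_factor_map F k \<phi>)"

lemma (in group) group_G_bar:
  assumes "\<phi> \<in> auto G"
  shows "group (G_bar G \<phi> k)"
proof -
  have A: "group (abelianization G)"
    unfolding abelianization_def by (rule normal.factorgroup_is_group[OF lower_central_normal])
  have "abelianization_map G \<phi> \<in> iso (abelianization G) (abelianization G)"
    using abelianization_map_auto[OF assms] by (auto simp: auto_def Bij_def iso_def)
  then show ?thesis
    unfolding G_bar_def
    by (intro group_semidirect_int tensor_power_map_auto A comm_group.axioms(2)
        comm_group_tensor_power)
qed

lemma (in group) group_G_hat:
  assumes "\<phi> \<in> auto G"
  shows "group (G_hat G \<phi> k)"
  unfolding G_hat_def
  by (intro group_semidirect_int lower_central_factor_map_auto assms)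
    (simp add: lower_central_factor_def normal.factorgroup_is_group[OF lower_central_Suc_normal])


section \<open>Residual properties\<close>

definition nilpotent_group :: "('a, 'b) monoid_scheme \<Rightarrow> bool"
  where "nilpotent_group G \<longleftrightarrow> group G \<and> (\<exists>c. lower_central G (Suc c) = {\<one>\<^bsub>G\<^esub>})"

definition finite_p_group :: "nat \<Rightarrow> ('a, 'b) monoid_scheme \<Rightarrow> bool"
  where "finite_p_group p G \<longleftrightarrow> group G \<and> finite (carrier G) \<and> (\<exists>m. order G = p ^ m)"

text \<open>A definition cannot quantify over the type of the target group. Groups of sets of elements
  of \<open>G\<close> suffice, because they include all quotients of \<open>G\<close>; see
  \<open>residually_nilpotentI\<close> and \<open>residually_p_finiteI\<close>, where the target has an
  arbitrary type.\<close>

definition residually_nilpotent :: "('a, 'b) monoid_scheme \<Rightarrow> bool"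
  where "residually_nilpotent G \<longleftrightarrow>
    (\<forall>x \<in> carrier G. x \<noteq> \<one>\<^bsub>G\<^esub> \<longrightarrow>
      (\<exists>(H :: 'a set monoid) h. nilpotent_group H \<and> h \<in> hom G H \<and> h x \<noteq> \<one>\<^bsub>H\<^esub>))"

definition residually_p_finite :: "nat \<Rightarrow> ('a, 'b) monoid_scheme \<Rightarrow> bool"
  where "residually_p_finite p G \<longleftrightarrow>
    (\<forall>x \<in> carrier G. x \<noteq> \<one>\<^bsub>G\<^esub> \<longrightarrow>
      (\<exists>(H :: 'a set monoid) h. finite_p_group p H \<and> h \<in> hom G H \<and> h x \<noteq> \<one>\<^bsub>H\<^esub>))"

lemma nilpotent_group_mon:
  assumes "group K" "nilpotent_group H" "f \<in> hom K H" "inj_on f (carrier K)"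
  shows "nilpotent_group K"
proof -
  obtain c where c: "group H" "lower_central H (Suc c) = {\<one>\<^bsub>H\<^esub>}"
    using assms(2) by (auto simp: nilpotent_group_def)
  interpret f: group_hom K H f
    using assms(1,3) c(1) by (simp add: group_hom_def group_hom_axioms_def)
  have "x = \<one>\<^bsub>K\<^esub>" if "x \<in> lower_central K (Suc c)" for x
  proof -
    have "f x = f \<one>\<^bsub>K\<^esub>"
      using f.lower_central_image(1)[of "Suc c"] that c(2) by auto
    then show ?thesis
      using inj_onD[OF assms(4)] that f.G.lower_central_subset by blast
  qed
  moreover have "\<one>\<^bsub>K\<^esub> \<in> lower_central K (Suc c)"
    by (rule subgroup.one_closed[OF normal_imp_subgroup[OF f.G.lower_central_normal]])
  ultimately show ?thesis
    using assms(1) unfolding nilpotent_group_def by blast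
qed

lemma finite_p_group_mon:
  assumes "prime p" "group K" "finite_p_group p H" "f \<in> hom K H" "inj_on f (carrier K)"
  shows "finite_p_group p K"
proof -
  obtain m where m: "group H" "finite (carrier H)" "order H = p ^ m"
    using assms(3) by (auto simp: finite_p_group_def)
  interpret f: group_hom K H f
    using assms(2,4) m(1) by (simp add: group_hom_def group_hom_axioms_def)
  have "subgroup (f ` carrier K) H"
    by (rule f.img_is_subgroup)
  then have "card (f ` carrier K) dvd p ^ m"
    using f.H.lagrange m(3) by (metis dvd_triv_right)
  then have "order K dvd p ^ m"
    by (simp add: order_def card_image assms(5))
  then obtain j where "order K = p ^ j"
    using divides_primepow_nat[OF assms(1)] by blast
  moreover have "finite (carrier K)"
    using assms(5) m(2) f.img_is_subgroup by (metis finite_imageD finite_subset subgroup.subset)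
  ultimately show ?thesis
    using assms(2) by (auto simp: finite_p_group_def)
qed

lemma quotient_separates:
  assumes "group G" "group H" "h \<in> hom G H" "x \<in> carrier G" "h x \<noteq> \<one>\<^bsub>H\<^esub>"
  obtains Q :: "'a set monoid" and q f where "group Q" "q \<in> hom (G :: ('a, 'b) monoid_scheme) Q"
    "q x \<noteq> \<one>\<^bsub>Q\<^esub>" "f \<in> hom Q H" "inj_on f (carrier Q)"
proof -
  interpret h: group_hom G H h
    using assms(1-3) by (simp add: group_hom_def group_hom_axioms_def)
  let ?N = "kernel G H h"
  interpret N: normal ?N G
    by (rule h.normal_kernel)
  have "x \<in> ?N #>\<^bsub>G\<^esub> x"
    by (rule h.G.rcos_self[OF assms(4) N.subgroup_axioms])
  moreover have "x \<notin> ?N"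
    using assms(5) unfolding kernel_def by blast
  ultimately have "?N #>\<^bsub>G\<^esub> x \<noteq> \<one>\<^bsub>G Mod ?N\<^esub>"
    unfolding one_FactGroup by blast
  then show thesis
    by (rule that[OF N.factorgroup_is_group N.r_coset_hom_Mod _ h.FactGroup_hom h.FactGroup_inj_on])
qed

lemma residually_nilpotentI:
  assumes "group G"
    and "\<And>x. x \<in> carrier G \<Longrightarrow> x \<noteq> \<one>\<^bsub>G\<^esub> \<Longrightarrow>
      \<exists>(H :: 'c monoid) h. nilpotent_group H \<and> h \<in> hom G H \<and> h x \<noteq> \<one>\<^bsub>H\<^esub>"
  shows "residually_nilpotent G"
  unfolding residually_nilpotent_def
proof (intro ballI impI)
  fix x assume x: "x \<in> carrier G" "x \<noteq> \<one>\<^bsub>G\<^esub>"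
  then obtain H :: "'c monoid" and h where H: "nilpotent_group H" "h \<in> hom G H" "h x \<noteq> \<one>\<^bsub>H\<^esub>"
    using assms(2) by blast
  then have "group H"
    by (simp add: nilpotent_group_def)
  then obtain Q :: "'a set monoid" and q f where "group Q" "q \<in> hom G Q" "q x \<noteq> \<one>\<^bsub>Q\<^esub>"
    "f \<in> hom Q H" "inj_on f (carrier Q)"
    using quotient_separates[OF assms(1) _ H(2) x(1) H(3)] by blast
  then show "\<exists>(Q :: 'a set monoid) q. nilpotent_group Q \<and> q \<in> hom G Q \<and> q x \<noteq> \<one>\<^bsub>Q\<^esub>"
    using nilpotent_group_mon[OF _ H(1)] by blast
qed

lemma residually_p_finiteI:
  assumes "prime p" "group G"
    and "\<And>x. x \<in> carrier G \<Longrightarrow> x \<noteq> \<one>\<^bsub>G\<^esub> \<Longrightarrow>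
      \<exists>(H :: 'c monoid) h. finite_p_group p H \<and> h \<in> hom G H \<and> h x \<noteq> \<one>\<^bsub>H\<^esub>"
  shows "residually_p_finite p G"
  unfolding residually_p_finite_def
proof (intro ballI impI)
  fix x assume x: "x \<in> carrier G" "x \<noteq> \<one>\<^bsub>G\<^esub>"
  then obtain H :: "'c monoid" and h where H: "finite_p_group p H" "h \<in> hom G H" "h x \<noteq> \<one>\<^bsub>H\<^esub>"
    using assms(3) by blast
  then have "group H"
    by (simp add: finite_p_group_def)
  then obtain Q :: "'a set monoid" and q f where "group Q" "q \<in> hom G Q" "q x \<noteq> \<one>\<^bsub>Q\<^esub>"
    "f \<in> hom Q H" "inj_on f (carrier Q)"
    using quotient_separates[OF assms(2) _ H(2) x(1) H(3)] by blast
  then show "\<exists>(Q :: 'a set monoid) q. finite_p_group p Q \<and> q \<in> hom G Q \<and> q x \<noteq> \<one>\<^bsub>Q\<^esub>"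
    using finite_p_group_mon[OF assms(1) _ H(1)] by blast
qed

end

theory Submission
  imports Defs "HOL-Library.List_Lexorder" "HOL-Algebra.Zassenhaus"
begin

text \<open>Sending \<open>x\<^sub>i\<close> to \<open>1 + X\<^sub>i\<close> (the Magnus expansion) and taking the leading term defines a
  homomorphism from \<open>\<gamma>\<^sub>k(F) / \<gamma>\<^sub>k\<^sub>+\<^sub>1(F)\<close> to the \<open>k\<close>-th tensor power of the abelianization. It takes
  group commutators to Lie brackets, so it commutes with the maps induced by \<open>\<phi>\<close>. It is injective:
  modulo \<open>\<gamma>\<^sub>k\<^sub>+\<^sub>1(F)\<close>, the iterated commutators along the standard bracketings of Lyndon words of length
  \<open>k\<close> generate \<open>\<gamma>\<^sub>k(F)\<close>, and the leading term of such a commutator is its Lyndon word plus larger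
  words, so these leading terms are linearly independent. Hence \<open>G_hat\<close> embeds in \<open>G_bar\<close>, and both
  residual properties pass to subgroups.\<close>


section \<open>Commutators and the lower central series\<close>

text \<open>Two obstacles shape the argument. The tensor power is a quotient by relators, so
  injectivity also needs the tensors of generators to be independent modulo
  \<open>tensor_relations\<close>; explicit coordinate functionals supply this. And the leading term
  is written in the basis of the generators, which \<phi> need not permute, so equivariance cannot
  be read off the coefficients. It is derived from the bracket rule for leading terms, which
  mentions no basis, along the commutators that generate \<gamma>_k. The spanning argument is the
  rewriting of Lie brackets into Lyndon brackets, carried out in the group itself: the Hall-Witt
  identity takes the place of the Jacobi identity, and its conjugations disappear modulo deeper
  terms of the series. Spanning and independence refer to the same finite family of trees, so the
  kernel of the leading term is found by elimination, with no count of ranks.\<close>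

definition commutator :: "('a, 'b) monoid_scheme \<Rightarrow> 'a \<Rightarrow> 'a \<Rightarrow> 'a"
  where "commutator G x y = x \<otimes>\<^bsub>G\<^esub> y \<otimes>\<^bsub>G\<^esub> inv\<^bsub>G\<^esub> x \<otimes>\<^bsub>G\<^esub> inv\<^bsub>G\<^esub> y"

context group
begin

lemma inv_cancel:
  assumes "x \<in> carrier G" "y \<in> carrier G"
  shows "inv x \<otimes> (x \<otimes> y) = y" "x \<otimes> (inv x \<otimes> y) = y"
  using assms by (simp_all flip: m_assoc)

lemma middle_factor:
  assumes "p \<otimes> q \<otimes> r = \<one>" "p \<in> carrier G" "q \<in> carrier G" "r \<in> carrier G"
  shows "q = inv p \<otimes> inv r"
proof -
  have "q = inv p \<otimes> (p \<otimes> q \<otimes> r) \<otimes> inv r"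
    using assms(2-) by (simp add: m_assoc inv_cancel)
  then show ?thesis
    using assms by simp
qed

lemma commutator_closed [simp]:
  "x \<in> carrier G \<Longrightarrow> y \<in> carrier G \<Longrightarrow> commutator G x y \<in> carrier G"
  by (simp add: commutator_def)

lemma commutator_self: "x \<in> carrier G \<Longrightarrow> commutator G x x = \<one>"
  by (simp add: commutator_def m_assoc inv_cancel)

lemma inv_commutator:
  "x \<in> carrier G \<Longrightarrow> y \<in> carrier G \<Longrightarrow> inv (commutator G x y) = commutator G y x"
  by (simp add: commutator_def m_assoc inv_mult_group)

lemma commutator_mult_right:
  "x \<in> carrier G \<Longrightarrow> y \<in> carrier G \<Longrightarrow> z \<in> carrier G \<Longrightarrow>
    commutator G x (y \<otimes> z) = commutator G x y \<otimes> (y \<otimes> commutator G x z \<otimes> inv y)"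
  by (simp add: commutator_def m_assoc inv_mult_group inv_cancel)

lemma commutator_inv_right:
  "x \<in> carrier G \<Longrightarrow> y \<in> carrier G \<Longrightarrow>
    commutator G x (inv y) = inv y \<otimes> inv (commutator G x y) \<otimes> y"
  by (simp add: commutator_def m_assoc inv_mult_group inv_cancel)

lemma conj_eq_commutator_mult:
  "g \<in> carrier G \<Longrightarrow> x \<in> carrier G \<Longrightarrow> g \<otimes> x \<otimes> inv g = commutator G g x \<otimes> x"
  by (simp add: commutator_def m_assoc)

lemma commutator_mult_swap:
  "x \<in> carrier G \<Longrightarrow> y \<in> carrier G \<Longrightarrow> commutator G x y \<otimes> (y \<otimes> x) = x \<otimes> y"
  by (simp add: commutator_def m_assoc inv_cancel)

lemma hall_witt:
  assumes "x \<in> carrier G" "y \<in> carrier G" "z \<in> carrier G"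
  shows "commutator G (commutator G x y) (y \<otimes> z \<otimes> inv y) \<otimes>
    commutator G (commutator G y z) (z \<otimes> x \<otimes> inv z) \<otimes>
    commutator G (commutator G z x) (x \<otimes> y \<otimes> inv x) = \<one>"
proof -
  \<comment> \<open>In terms of \<open>U\<close> the product telescopes.\<close>
  define U where "U = (\<lambda>x y z. x \<otimes> y \<otimes> inv x \<otimes> z \<otimes> x)"
  have U: "commutator G (commutator G x y) (y \<otimes> z \<otimes> inv y) = U x y z \<otimes> inv (U y z x)"
    if "x \<in> carrier G" "y \<in> carrier G" "z \<in> carrier G" for x y z
  proof -
    have "commutator G x y \<otimes> (y \<otimes> z \<otimes> inv y) = x \<otimes> y \<otimes> inv x \<otimes> z \<otimes> inv y"
      using that by (simp add: commutator_def m_assoc inv_cancel)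
    moreover have "inv (commutator G x y) \<otimes> inv (y \<otimes> z \<otimes> inv y) = y \<otimes> x \<otimes> inv y \<otimes> inv x \<otimes> y \<otimes> inv z \<otimes> inv y"
      using that by (simp add: inv_commutator) (simp add: commutator_def m_assoc inv_mult_group)
    ultimately show ?thesis
      using that unfolding commutator_def[of G "commutator G x y"]
      by (simp add: m_assoc U_def inv_mult_group inv_cancel)
  qed
  have "U x y z \<in> carrier G" if "x \<in> carrier G" "y \<in> carrier G" "z \<in> carrier G" for x y z
    using that by (simp add: U_def)
  then show ?thesis
    using assms by (simp only: U) (simp add: m_assoc inv_cancel)
qed

lemma lower_central_antimono: "a \<le> b \<Longrightarrow> lower_central G b \<subseteq> lower_central G a"
  using lower_central_Suc_subset by (rule lift_Suc_antimono_le)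

lemma lower_central_Suc:
  "1 \<le> k \<Longrightarrow> lower_central G (Suc k) =
    generate G (\<Union>x\<in>lower_central G k. \<Union>y\<in>carrier G. {commutator G x y})"
  by (cases k) (simp_all add: commutator_subgroup_def commutator_def)

lemma lower_central_commutator_Suc:
  "1 \<le> k \<Longrightarrow> x \<in> lower_central G k \<Longrightarrow> y \<in> carrier G \<Longrightarrow>
    commutator G x y \<in> lower_central G (Suc k)"
  unfolding lower_central_Suc by (blast intro: generate.incl)

lemma lower_central_closed [simp]: "x \<in> lower_central G k \<Longrightarrow> x \<in> carrier G"
  using lower_central_subset by blast

end

context normal
begin

text \<open>Since \<open>H\<close> is normal, [x, y z] = [x, y] y [x, z] y^-1 shows that triviality
  of the commutator modulo \<open>H\<close> passes to products. Hence commutators with a fixed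
  element need only be tested on generators.\<close>

lemma commutator_subgroup_right:
  assumes "x \<in> carrier G"
  shows "subgroup {y \<in> carrier G. commutator G x y \<in> H} G"
proof (rule subgroupI)
  show "{y \<in> carrier G. commutator G x y \<in> H} \<noteq> {}"
    using assms by (auto simp: commutator_def intro!: exI[of _ "\<one>"])
next
  fix y assume "y \<in> {y \<in> carrier G. commutator G x y \<in> H}"
  then show "inv y \<in> {y \<in> carrier G. commutator G x y \<in> H}"
    using assms inv_op_closed1 by (simp add: commutator_inv_right)
next
  fix y z assume "y \<in> {y \<in> carrier G. commutator G x y \<in> H}" "z \<in> {y \<in> carrier G. commutator G x y \<in> H}"
  then show "y \<otimes> z \<in> {y \<in> carrier G. commutator G x y \<in> H}"
    using assms inv_op_closed2 by (simp add: commutator_mult_right)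
qed auto

lemma commutator_swap_mem:
  "x \<in> carrier G \<Longrightarrow> y \<in> carrier G \<Longrightarrow> commutator G x y \<in> H \<Longrightarrow> commutator G y x \<in> H"
  by (metis inv_commutator m_inv_closed)

lemma commutator_generate_right:
  assumes "x \<in> carrier G" "Y \<subseteq> carrier G" "\<And>y. y \<in> Y \<Longrightarrow> commutator G x y \<in> H" "y \<in> generate G Y"
  shows "commutator G x y \<in> H"
  using generate_subgroup_incl[OF _ commutator_subgroup_right[OF assms(1)], of Y] assms by blast

end

context group
begin

text \<open>A three-subgroups argument: \<gamma>_(b+1) is generated by commutators [y, z], and the
  Hall-Witt identity traces [[y, z], x] back to two commutators that the induction on
  \<open>b\<close> already places in \<gamma>_(a+b+1).\<close>

lemma lower_central_commutator:
  "1 \<le> b \<Longrightarrow> 1 \<le> a \<Longrightarrow> x \<in> lower_central G a \<Longrightarrow> y \<in> lower_central G b \<Longrightarrow>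
    commutator G x y \<in> lower_central G (a + b)"
proof (induction b arbitrary: a x y rule: nat_induct_at_least)
  case base
  then show ?case
    using lower_central_commutator_Suc by simp
next
  case (Suc b)
  interpret N: normal "lower_central G (a + Suc b)" G
    by (rule lower_central_normal)
  show ?case
  proof (rule N.commutator_generate_right)
    show "y \<in> generate G (\<Union>y\<in>lower_central G b. \<Union>z\<in>carrier G. {commutator G y z})"
      using Suc by (simp add: lower_central_Suc)
  next
    fix c assume "c \<in> (\<Union>y\<in>lower_central G b. \<Union>z\<in>carrier G. {commutator G y z})"
    then obtain y z where yz: "y \<in> lower_central G b" "z \<in> carrier G" "c = commutator G y z"
      by blast
    interpret A: normal "lower_central G a" G
      by (rule lower_central_normal)
    interpret B: normal "lower_central G b" G
      by (rule lower_central_normal)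
    \<comment> \<open>With this conjugate in the role of \<open>x\<close>, the conjugated entry of
      the middle Hall-Witt factor becomes \<open>x\<close> itself.\<close>
    define x' where "x' = inv z \<otimes> x \<otimes> z"
    have x': "x' \<in> lower_central G a"
      using A.inv_op_closed1[OF yz(2)] Suc.prems by (simp add: x'_def)
    have x: "x = z \<otimes> x' \<otimes> inv z"
      using Suc.prems yz by (simp add: x'_def m_assoc inv_cancel)
    let ?p = "commutator G (commutator G x' y) (y \<otimes> z \<otimes> inv y)"
      and ?q = "commutator G (commutator G y z) x"
      and ?r = "commutator G (commutator G z x') (x' \<otimes> y \<otimes> inv x')"
    have p: "?p \<in> lower_central G (a + Suc b)"
      using lower_central_commutator_Suc[of "a + b" "commutator G x' y"] Suc.IH[OF _ x' yz(1)] Suc x' yz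
      by simp
    \<comment> \<open>The weight moves from \<open>y\<close> to the other entry, so the induction
      hypothesis for \<open>b\<close> is needed at \<open>Suc a\<close>.\<close>
    have "commutator G z x' \<in> lower_central G (Suc a)"
      using normal.commutator_swap_mem[OF lower_central_normal _ _ lower_central_commutator_Suc[of a x' z]]
        x' yz Suc.prems by simp
    moreover have "x' \<otimes> y \<otimes> inv x' \<in> lower_central G b"
      using B.inv_op_closed2 x' yz by simp
    ultimately have r: "?r \<in> lower_central G (a + Suc b)"
      using Suc.IH[of "Suc a"] by simp
    have "?p \<otimes> ?q \<otimes> ?r = \<one>"
      using hall_witt[of x' y z] x' yz x by simp
    moreover have "?p \<in> carrier G" "?q \<in> carrier G" "?r \<in> carrier G"
      using x' yz Suc.prems by simp_all
    ultimately have "?q = inv ?p \<otimes> inv ?r"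
      by (rule middle_factor)
    then show "commutator G x c \<in> lower_central G (a + Suc b)"
      using p r N.m_closed[OF N.m_inv_closed N.m_inv_closed] N.commutator_swap_mem[of c x] yz Suc.prems
      by (metis N.commutator_swap_mem commutator_closed lower_central_closed)
  qed (use Suc.prems in auto)
qed

text \<open>\<gamma>_m is central modulo \<gamma>_(m+1): conjugation changes an element of
  \<open>S\<close> by a commutator that lies in \<gamma>_(m+1), hence in \<open>S\<close>.\<close>

lemma central_section_normal:
  assumes "subgroup S G" "1 \<le> m" "lower_central G (Suc m) \<subseteq> S" "S \<subseteq> lower_central G m"
  shows "S \<lhd> G"
proof -
  interpret S: subgroup S G by fact
  have "g \<otimes> x \<otimes> inv g \<in> S" if "g \<in> carrier G" "x \<in> S" for g x
  proof -
    have "commutator G x g \<in> S"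
      using assms that lower_central_commutator_Suc by blast
    then have "inv (commutator G x g) \<in> S"
      by (rule S.m_inv_closed)
    then show ?thesis
      using that by (simp add: inv_commutator conj_eq_commutator_mult)
  qed
  then show ?thesis
    using assms(1) by (simp add: normal_inv_iff)
qed

text \<open>Conjugating \<open>x\<close> by \<open>g\<close> multiplies it by [g, x], and [w,
  [g, x]] has weight a + b + c, which \<open>S\<close> absorbs. This removes the conjugations from
  the Hall-Witt identity.\<close>

lemma commutator_conj_mem:
  assumes "S \<lhd> G" "lower_central G (a + b + c) \<subseteq> S" "1 \<le> a" "1 \<le> b" "1 \<le> c"
    and "w \<in> lower_central G a" "x \<in> lower_central G b" "g \<in> lower_central G c"
    and "commutator G w x \<in> S"
  shows "commutator G w (g \<otimes> x \<otimes> inv g) \<in> S"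
proof -
  interpret S: normal S G by fact
  have gx: "commutator G g x \<in> lower_central G (c + b)"
    using assms by (intro lower_central_commutator)
  then have "commutator G w (commutator G g x) \<in> lower_central G (a + (c + b))"
    using assms by (intro lower_central_commutator) auto
  then have "commutator G w (commutator G g x) \<in> S"
    using assms(2) by (auto simp: ac_simps)
  moreover have "x \<in> carrier G" "g \<in> carrier G" "w \<in> carrier G"
    using assms by auto
  ultimately show ?thesis
    using assms(9) S.inv_op_closed2
    by (simp add: conj_eq_commutator_mult commutator_mult_right)
qed

text \<open>The Hall-Witt identity modulo \<open>S\<close>: each conjugation costs a commutator of
  weight above a + b + c, so the three factors may be replaced by plain double commutators.\<close>

lemma jacobi_mem:
  assumes "S \<lhd> G" "lower_central G (Suc (a + b + c)) \<subseteq> S" "1 \<le> a" "1 \<le> b" "1 \<le> c"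
    and x: "x \<in> lower_central G a" and y: "y \<in> lower_central G b" and z: "z \<in> lower_central G c"
    and "commutator G (commutator G y z) x \<in> S" "commutator G (commutator G z x) y \<in> S"
  shows "commutator G (commutator G x y) z \<in> S"
proof -
  interpret S: normal S G by fact
  have carr: "x \<in> carrier G" "y \<in> carrier G" "z \<in> carrier G"
    using x y z by auto
  have comm: "commutator G x y \<in> lower_central G (a + b)"
    "commutator G y z \<in> lower_central G (b + c)" "commutator G z x \<in> lower_central G (c + a)"
    using assms by (auto intro: lower_central_commutator)
  have S: "lower_central G m \<subseteq> S" if "a + b + c < m" for m
    using lower_central_antimono[of "Suc (a + b + c)" m] assms(2) that by simp
  let ?p = "commutator G (commutator G x y) (y \<otimes> z \<otimes> inv y)"
    and ?q = "commutator G (commutator G y z) (z \<otimes> x \<otimes> inv z)"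
    and ?r = "commutator G (commutator G z x) (x \<otimes> y \<otimes> inv x)"
  have q: "?q \<in> S"
    using commutator_conj_mem[OF assms(1) S _ _ _ comm(2) x z] assms by simp
  have r: "?r \<in> S"
    using commutator_conj_mem[OF assms(1) S _ _ _ comm(3) y x] assms by simp
  have "?p \<otimes> ?q \<otimes> ?r = \<one>"
    by (rule hall_witt[OF carr])
  then have "?p = inv (?q \<otimes> ?r)"
    using carr by (intro inv_equality[symmetric]) (simp_all add: m_assoc)
  then have p: "?p \<in> S"
    using q r by simp
  \<comment> \<open>Conjugating back by the inverse of \<open>y\<close> frees the last entry of
    \<open>?p\<close>.\<close>
  have "inv y \<in> lower_central G b"
    using subgroup.m_inv_closed[OF normal_imp_subgroup[OF lower_central_normal] y] .
  moreover have "y \<otimes> z \<otimes> inv y \<in> lower_central G c"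
    using normal.inv_op_closed2[OF lower_central_normal carr(2) z] .
  ultimately have "commutator G (commutator G x y) (inv y \<otimes> (y \<otimes> z \<otimes> inv y) \<otimes> inv (inv y)) \<in> S"
    using commutator_conj_mem[OF assms(1) S _ _ _ comm(1), of c b "y \<otimes> z \<otimes> inv y" "inv y"] assms p
    by simp
  then show ?thesis
    using carr by (simp add: m_assoc inv_cancel)
qed

end


section \<open>Lyndon trees\<close>

datatype magma = Gen nat | Br magma magma

primrec foliage :: "magma \<Rightarrow> nat list"
  where
    "foliage (Gen i) = [i]"
  | "foliage (Br s t) = foliage s @ foliage t"

text \<open>The foliage of such a tree is a Lyndon word, that is, smaller than its proper suffixes. The
  condition on the right subtree of \<open>s\<close> makes \<open>foliage t\<close> the smallest proper suffix, so that the
  tree is the standard bracketing of its foliage.\<close>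

fun lyndon_tree :: "nat \<Rightarrow> magma \<Rightarrow> bool"
  where
    "lyndon_tree n (Gen i) \<longleftrightarrow> i < n"
  | "lyndon_tree n (Br s t) \<longleftrightarrow> lyndon_tree n s \<and> lyndon_tree n t \<and> foliage s < foliage t \<and>
      (case s of Gen _ \<Rightarrow> True | Br _ s' \<Rightarrow> foliage t \<le> foliage s')"

section \<open>Lexicographic comparison of concatenated words\<close>

lemma append_less_append_iff [simp]: "(us @ xs < us @ ys) \<longleftrightarrow> xs < (ys :: nat list)"
  by (induction us) simp_all

lemma append_le_append_iff [simp]: "(us @ xs \<le> us @ ys) \<longleftrightarrow> xs \<le> (ys :: nat list)"
  by (simp add: list_le_def)

lemma less_append_right: "ys \<noteq> [] \<Longrightarrow> xs < xs @ (ys :: nat list)"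
  using append_less_append_iff[of xs "[]" ys] by (cases ys) simp_all

lemma le_append_right: "xs \<le> xs @ (ys :: nat list)"
  using less_append_right[of ys xs] by (cases "ys = []") simp_all

lemma append_less_append:
  "length xs = length ys \<Longrightarrow> xs < ys \<Longrightarrow> xs @ us < ys @ (vs :: nat list)"
  by (induction xs ys rule: list_induct2) auto

lemma append_less_appendD:
  "length xs = length ys \<Longrightarrow> xs @ us \<le> ys @ (vs :: nat list) \<Longrightarrow> xs \<le> ys"
  by (metis append_less_append leD leI)

text \<open>Unless \<open>xs\<close> is a prefix of \<open>ys\<close>, the comparison is decided
  before the appended letters are reached; the second hypothesis settles the prefix case.\<close>

lemma less_imp_append_less:
  "xs < ys \<Longrightarrow> (\<And>zs. ys = xs @ zs \<Longrightarrow> us < zs) \<Longrightarrow> xs @ us < (ys :: nat list)"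
proof (induction xs arbitrary: ys)
  case (Cons x xs)
  then show ?case by (cases ys) auto
qed simp

lemma foliage_not_Nil [simp]: "foliage t \<noteq> []"
  by (induction t) simp_all

lemma length_foliage_pos [simp]: "0 < length (foliage t)"
  by simp

lemma set_foliage: "lyndon_tree n t \<Longrightarrow> set (foliage t) \<subseteq> {..<n}"
  by (induction t) auto

text \<open>The two claims support each other, so they go through one induction. A proper suffix
  either lies inside \<open>foliage t\<close> or is a proper suffix of \<open>foliage s\<close>
  followed by \<open>foliage t\<close>; in the latter case the condition on the right subtree of
  \<open>s\<close> bounds it from below.\<close>

lemma lyndon_tree_suffix:
  assumes "lyndon_tree n t" "foliage t = us @ vs" "us \<noteq> []" "vs \<noteq> []"
  shows "foliage t < vs" and "t = Br s1 s2 \<Longrightarrow> foliage s2 \<le> vs"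
proof -
  have "foliage t < vs \<and> (\<forall>s1 s2. t = Br s1 s2 \<longrightarrow> foliage s2 \<le> vs)"
    using assms
  proof (induction t arbitrary: us vs)
    case (Gen i)
    then show ?case
      by (simp add: Cons_eq_append_conv)
  next
    case (Br s t)
    have s: "lyndon_tree n s" and t: "lyndon_tree n t" and st: "foliage s < foliage t"
      using Br.prems by auto
    \<comment> \<open>Only the case that \<open>foliage s\<close> is a prefix of
      \<open>foliage t\<close> needs an argument: the remainder is then a proper suffix of a Lyndon
      word.\<close>
    have less: "foliage s @ foliage t < foliage t"
    proof (rule less_imp_append_less[OF st])
      fix zs assume zs: "foliage t = foliage s @ zs"
      then have "zs \<noteq> []"
        using st by auto
      then show "foliage t < zs"
        using Br.IH(2)[OF t zs] by simp
    qed
    have le: "foliage t \<le> vs"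
    proof -
      obtain zs where "us = foliage s @ zs \<and> foliage t = zs @ vs \<or>
          foliage s = us @ zs \<and> vs = zs @ foliage t"
        using Br.prems(2) by (auto simp: append_eq_append_conv2)
      then consider "us = foliage s @ zs" "foliage t = zs @ vs" | "foliage s = us @ zs" "vs = zs @ foliage t"
        by blast
      then show ?thesis
      proof cases
        case 1
        then show ?thesis
          using Br.IH(2)[OF t, of zs vs] Br.prems(4) by (cases "zs = []") auto
      next
        case 2
        show ?thesis
        proof (cases "zs = []")
          case False
          then obtain s1 s2 where s_eq: "s = Br s1 s2"
            using 2 Br.prems(3) by (cases s) (auto simp: Cons_eq_append_conv)
          have "foliage t \<le> foliage s2"
            using Br.prems(1) s_eq by simp
          also have "\<dots> \<le> zs"
            using Br.IH(1)[OF s 2(1) Br.prems(3) False] s_eq by blast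
          also have "\<dots> \<le> vs"
            using 2 le_append_right by simp
          finally show ?thesis .
        qed (use 2 in simp)
      qed
    qed
    show ?case
      using less le by auto
  qed
  then show "foliage t < vs" and "t = Br s1 s2 \<Longrightarrow> foliage s2 \<le> vs"
    by blast+
qed

lemma lyndon_tree_Br_less:
  assumes "lyndon_tree n (Br s t)"
  shows "foliage (Br s t) < foliage t"
  using lyndon_tree_suffix(1)[OF assms, of "foliage s" "foliage t"] by simp

text \<open>The word of the right subtree is the least proper suffix, so the word alone determines
  where the tree splits.\<close>

lemma foliage_inj: "lyndon_tree n s \<Longrightarrow> lyndon_tree n t \<Longrightarrow> foliage s = foliage t \<Longrightarrow> s = t"
proof (induction s arbitrary: t)
  case (Gen i)
  then show ?case
    by (cases t) (auto simp: Cons_eq_append_conv)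
next
  case (Br s1 s2)
  then obtain t1 t2 where t: "t = Br t1 t2"
    by (cases t) (auto simp: append_eq_Cons_conv)
  have "foliage s2 \<le> foliage t2"
    using lyndon_tree_suffix(2)[OF Br.prems(1), of "foliage t1" "foliage t2"] Br.prems(3) t by simp
  moreover have "foliage t2 \<le> foliage s2"
    using lyndon_tree_suffix(2)[OF Br.prems(2), of "foliage s1" "foliage s2"] Br.prems(3) t by simp
  ultimately have "foliage s2 = foliage t2"
    by simp
  then show ?case
    using Br t by auto
qed


section \<open>Spanning by Lyndon commutators\<close>

primrec tree_commutator :: "('a, 'b) monoid_scheme \<Rightarrow> (nat \<Rightarrow> 'a) \<Rightarrow> magma \<Rightarrow> 'a"
  where
    "tree_commutator G x (Gen i) = x i"
  | "tree_commutator G x (Br s t) = commutator G (tree_commutator G x s) (tree_commutator G x t)"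

text \<open>Including \<gamma>_(k+1) makes this the preimage of a subgroup of a central section,
  hence normal for k at least 1. The parameter \<open>T\<close> lets the rewriting carry an upper
  bound on the words, and lets the elimination remove trees one at a time.\<close>

definition lyndon_span ::
  "('a, 'b) monoid_scheme \<Rightarrow> (nat \<Rightarrow> 'a) \<Rightarrow> nat \<Rightarrow> nat \<Rightarrow> magma set \<Rightarrow> 'a set"
  where "lyndon_span G x n k T = generate G
    (tree_commutator G x ` {t \<in> T. lyndon_tree n t \<and> length (foliage t) = k} \<union> lower_central G (Suc k))"

locale group_gens = group G for G (structure) +
  fixes x :: "nat \<Rightarrow> 'a" and n :: nat
  assumes gens_closed: "i < n \<Longrightarrow> x i \<in> carrier G"
begin

abbreviation "com \<equiv> tree_commutator G x"
abbreviation "span \<equiv> lyndon_span G x n"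

lemma com_mem: "lyndon_tree n t \<Longrightarrow> com t \<in> lower_central G (length (foliage t))"
proof (induction t)
  case (Gen i)
  then show ?case
    by (simp add: gens_closed)
next
  case (Br s t)
  have "1 \<le> length (foliage s)" "1 \<le> length (foliage t)"
    by (simp_all add: Suc_le_eq)
  then show ?case
    using Br by (simp add: lower_central_commutator)
qed

lemma com_closed [simp]: "lyndon_tree n t \<Longrightarrow> com t \<in> carrier G"
  using com_mem lower_central_closed by blast

lemma span_gens_subset:
  "com ` {t \<in> T. lyndon_tree n t \<and> length (foliage t) = k} \<union> lower_central G (Suc k) \<subseteq> lower_central G k"
  using com_mem lower_central_Suc_subset by blast

lemma span_subset: "span k T \<subseteq> lower_central G k"
  unfolding lyndon_span_def
  by (rule generate_subgroup_incl[OF span_gens_subset normal_imp_subgroup[OF lower_central_normal]])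

lemma span_gens_subset_carrier:
  "com ` {t \<in> T. lyndon_tree n t \<and> length (foliage t) = k} \<union> lower_central G (Suc k) \<subseteq> carrier G"
  using span_gens_subset lower_central_subset by blast

lemma span_normal:
  assumes "1 \<le> k"
  shows "span k T \<lhd> G"
proof (rule central_section_normal[OF _ assms])
  show "subgroup (span k T) G"
    unfolding lyndon_span_def by (rule generate_is_subgroup[OF span_gens_subset_carrier])
  show "lower_central G (Suc k) \<subseteq> span k T"
    unfolding lyndon_span_def by (blast intro: generate.incl)
qed (rule span_subset)

lemma lower_central_subset_span: "lower_central G (Suc k) \<subseteq> span k T"
  unfolding lyndon_span_def by (blast intro: generate.incl)

lemma com_in_span:
  "t \<in> T \<Longrightarrow> lyndon_tree n t \<Longrightarrow> length (foliage t) = k \<Longrightarrow> com t \<in> span k T"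
  unfolding lyndon_span_def by (blast intro: generate.incl)

lemma span_mono: "T \<subseteq> T' \<Longrightarrow> span k T \<subseteq> span k T'"
  unfolding lyndon_span_def by (rule mono_generate) blast

text \<open>A test on the Lyndon generators suffices, because the other generators of the span have
  weight k + 1 and their commutators with \<open>y\<close> fall into \<gamma>_(a+k+1).\<close>

lemma commutator_span:
  assumes "S \<lhd> G" "lower_central G (Suc (a + k)) \<subseteq> S" "1 \<le> a" "1 \<le> k"
    and "y \<in> lower_central G a" "z \<in> span k T"
    and "\<And>t. t \<in> T \<Longrightarrow> lyndon_tree n t \<Longrightarrow> length (foliage t) = k \<Longrightarrow> commutator G y (com t) \<in> S"
  shows "commutator G y z \<in> S"
proof -
  interpret S: normal S G by fact
  show ?thesis
  proof (rule S.commutator_generate_right[OF _ span_gens_subset_carrier])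
    show "z \<in> generate G (com ` {t \<in> T. lyndon_tree n t \<and> length (foliage t) = k} \<union> lower_central G (Suc k))"
      using assms(6) by (simp add: lyndon_span_def)
    fix u assume "u \<in> com ` {t \<in> T. lyndon_tree n t \<and> length (foliage t) = k} \<union> lower_central G (Suc k)"
    then show "commutator G y u \<in> S"
      using assms(7) lower_central_commutator[of "Suc k" a y u] assms(2-5) by auto
  qed (use assms in auto)
qed

text \<open>If \<open>Br s t\<close> is not itself a Lyndon tree, then \<open>s = Br s1 s2\<close> with
  \<open>foliage s2 < foliage t\<close>, and the Jacobi identity reduces the commutator to ones in which the
  larger of the two foliages has decreased.\<close>

lemma commutator_com_mem_span:
  assumes "lyndon_tree n s" "lyndon_tree n t" "foliage s < foliage t"
    "length (foliage s) + length (foliage t) = k"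
  shows "commutator G (com s) (com t) \<in> span k {u. foliage u < foliage t}"
  using assms
proof (induction k arbitrary: s t rule: less_induct)
  case (less k)
  \<comment> \<open>The lexicographic order has infinite descending chains when lengths are
    unbounded. Inside this finite set, the number of words below \<open>foliage t\<close> measures
    the inner induction.\<close>
  define words where "words = {w. set w \<subseteq> {..<n} \<and> length w \<le> k}"
  have fin: "finite words"
    unfolding words_def by (rule finite_lists_length_le) simp
  note IH_length = less.IH
  show ?case
    using less.prems
  proof (induction "card {w \<in> words. w < foliage t}" arbitrary: s t rule: less_induct)
    case (less t s)
    let ?S = "span k {u. foliage u < foliage t}"
    have k: "1 \<le> k"
      using less.prems(4) length_foliage_pos[of s] by linarith
    interpret S: normal ?S G
      by (rule span_normal[OF k])
    \<comment> \<open>The inner hypothesis without an order on the pair: exchanging the entries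
      inverts the commutator, and equal trees give the identity.\<close>
    have IH: "commutator G (com u) (com v) \<in> ?S"
      if uv: "lyndon_tree n u" "lyndon_tree n v" "foliage u < foliage t" "foliage v < foliage t"
        "length (foliage u) + length (foliage v) = k" for u v
    proof -
      have lt: "commutator G (com u) (com v) \<in> ?S"
        if uv: "lyndon_tree n u" "lyndon_tree n v" "foliage u < foliage v" "foliage v < foliage t"
          "length (foliage u) + length (foliage v) = k" for u v
      proof -
        have "foliage v \<in> words"
          using uv set_foliage[OF uv(2)] by (simp add: words_def)
        then have "{w \<in> words. w < foliage v} \<subset> {w \<in> words. w < foliage t}"
          using uv(4) by auto
        then have "card {w \<in> words. w < foliage v} < card {w \<in> words. w < foliage t}"
          using fin by (intro psubset_card_mono) auto
        then have "commutator G (com u) (com v) \<in> span k {w. foliage w < foliage v}"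
          using less.hyps uv by blast
        moreover have "span k {w. foliage w < foliage v} \<subseteq> ?S"
          using uv(4) by (intro span_mono) auto
        ultimately show ?thesis
          by blast
      qed
      consider "foliage u < foliage v" | "foliage v < foliage u" | "u = v"
        using foliage_inj[OF uv(1,2)] less_linear by blast
      then show ?thesis
      proof cases
        case 1
        then show ?thesis
          using lt uv by blast
      next
        case 2
        then have "commutator G (com v) (com u) \<in> ?S"
          using lt uv by (simp add: add.commute)
        then show ?thesis
          using uv by (intro S.commutator_swap_mem[of "com v"]) auto
      next
        case 3
        then show ?thesis
          using uv by (simp add: commutator_self)
      qed
    qed
    show ?case
    proof (cases "lyndon_tree n (Br s t)")
      case True
      then have "com (Br s t) \<in> ?S"
        using less.prems(4) lyndon_tree_Br_less[OF True] by (intro com_in_span) auto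
      then show ?thesis
        by simp
    next
      case False
      then obtain s1 s2 where s: "s = Br s1 s2" and s2t: "foliage s2 < foliage t"
        using less.prems by (cases s) auto
      have ly: "lyndon_tree n s1" "lyndon_tree n s2" "foliage s1 < foliage s2"
        using less.prems(1) s by auto
      have s1t: "foliage s1 < foliage t"
        using ly(3) s2t by simp
      have len: "length (foliage s1) + length (foliage s2) + length (foliage t) = k"
        using less.prems(4) s by simp
      have pos: "1 \<le> length (foliage u)" for u
        by (simp add: Suc_le_eq)
      \<comment> \<open>[s2, t] has smaller total length, so the outer hypothesis expresses it, up
        to deeper terms, by trees below \<open>foliage t\<close>. Since \<open>s1\<close> is below
        as well, \<open>IH\<close> applies to each resulting pair.\<close>
      have 1: "commutator G (commutator G (com s2) (com t)) (com s1) \<in> ?S"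
      proof (rule S.commutator_swap_mem)
        have mem: "commutator G (com s2) (com t) \<in>
            span (length (foliage s2) + length (foliage t)) {u. foliage u < foliage t}"
          using IH_length[OF _ ly(2) less.prems(2) s2t] len pos[of s1] by simp
        show "commutator G (com s1) (commutator G (com s2) (com t)) \<in> ?S"
        proof (rule commutator_span[OF S.normal_axioms _ pos _ com_mem[OF ly(1)] mem])
          show "lower_central G (Suc (length (foliage s1) + (length (foliage s2) + length (foliage t)))) \<subseteq> ?S"
            using lower_central_subset_span[of k] len by (simp add: ac_simps)
          show "1 \<le> length (foliage s2) + length (foliage t)"
            using pos[of t] by simp
          show "commutator G (com s1) (com u) \<in> ?S"
            if "u \<in> {u. foliage u < foliage t}" "lyndon_tree n u"
              "length (foliage u) = length (foliage s2) + length (foliage t)" for u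
            using IH[OF ly(1) that(2) s1t] that len by simp
        qed
      qed (use ly less.prems in auto)
      have 2: "commutator G (com s2) (commutator G (com s1) (com t)) \<in> ?S"
      proof -
        have mem: "commutator G (com s1) (com t) \<in>
            span (length (foliage s1) + length (foliage t)) {u. foliage u < foliage t}"
          using IH_length[OF _ ly(1) less.prems(2) s1t] len pos[of s2] by simp
        show "commutator G (com s2) (commutator G (com s1) (com t)) \<in> ?S"
        proof (rule commutator_span[OF S.normal_axioms _ pos _ com_mem[OF ly(2)] mem])
          show "lower_central G (Suc (length (foliage s2) + (length (foliage s1) + length (foliage t)))) \<subseteq> ?S"
            using lower_central_subset_span[of k] len by (simp add: ac_simps)
          show "1 \<le> length (foliage s1) + length (foliage t)"
            using pos[of t] by simp
          show "commutator G (com s2) (com u) \<in> ?S"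
            if "u \<in> {u. foliage u < foliage t}" "lyndon_tree n u"
              "length (foliage u) = length (foliage s1) + length (foliage t)" for u
            using IH[OF ly(2) that(2) s2t] that len by simp
        qed
      qed
      \<comment> \<open>The Jacobi step needs [t, s1], the inverse of the commutator to which the
        outer hypothesis was applied.\<close>
      have "inv (commutator G (com s1) (com t)) = commutator G (com t) (com s1)"
        using ly less.prems by (simp add: inv_commutator)
      moreover have "subgroup {y \<in> carrier G. commutator G (com s2) y \<in> ?S} G"
        using ly by (intro S.commutator_subgroup_right) auto
      ultimately have "commutator G (com s2) (commutator G (com t) (com s1)) \<in> ?S"
        using 2 ly less.prems subgroup.m_inv_closed[of "{y \<in> carrier G. commutator G (com s2) y \<in> ?S}" G
            "commutator G (com s1) (com t)"] by simp
      then have 3: "commutator G (commutator G (com t) (com s1)) (com s2) \<in> ?S"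
        using ly less.prems by (intro S.commutator_swap_mem[of "com s2"]) auto
      have "commutator G (commutator G (com s1) (com s2)) (com t) \<in> ?S"
        using lower_central_subset_span[of k] len
        by (intro jacobi_mem[OF span_normal[OF k] _ pos pos pos com_mem[OF ly(1)] com_mem[OF ly(2)]
            com_mem[OF less.prems(2)] 1 3]) simp
      then show ?thesis
        by (simp add: s)
    qed
  qed
qed

text \<open>\<gamma>_(k+1) is generated by commutators [y, z] with y in \<gamma>_k. By induction and
  by the generation of \<open>G\<close>, it suffices to take a Lyndon commutator for
  \<open>y\<close> and a generator for \<open>z\<close>. The latter is the Lyndon tree
  \<open>Gen i\<close>, so \<open>commutator_com_mem_span\<close> applies once the pair is ordered
  by foliage.\<close>

theorem lower_central_eq_span:
  assumes gen: "generate G (x ` {..<n}) = carrier G" and "1 \<le> k"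
  shows "lower_central G k = span k UNIV"
  using assms(2)
proof (induction k rule: nat_induct_at_least)
  case base
  have "x ` {..<n} \<subseteq> com ` {t \<in> UNIV. lyndon_tree n t \<and> length (foliage t) = 1}"
    by (auto intro!: image_eqI[of "x _" com "Gen _"])
  then have "generate G (x ` {..<n}) \<subseteq> span 1 UNIV"
    unfolding lyndon_span_def by (intro mono_generate) blast
  then show ?case
    using span_subset[of 1 UNIV] gen by auto
next
  case (Suc k)
  let ?S = "span (Suc k) UNIV"
  interpret S: normal ?S G
    by (rule span_normal) simp
  have "commutator G y z \<in> ?S" if y: "y \<in> lower_central G k" and z: "z \<in> carrier G" for y z
  proof (rule S.commutator_swap_mem)
    show "commutator G z y \<in> ?S"
    proof (rule commutator_span[of ?S 1 k z y UNIV])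
      fix t assume t: "lyndon_tree n t" "length (foliage t) = k"
      have "commutator G (com t) (x i) \<in> ?S" if "i < n" for i
      proof -
        have i: "lyndon_tree n (Gen i)" "com (Gen i) = x i"
          using that by simp_all
        consider "foliage t < foliage (Gen i)" | "foliage (Gen i) < foliage t" | "t = Gen i"
          using foliage_inj[OF t(1) i(1)] less_linear by blast
        then show ?thesis
        proof cases
          case 1
          then have "commutator G (com t) (com (Gen i)) \<in> span (Suc k) {u. foliage u < foliage (Gen i)}"
            using t i by (intro commutator_com_mem_span) simp_all
          then show ?thesis
            using span_mono[of "{u. foliage u < foliage (Gen i)}" UNIV "Suc k"] i(2) by auto
        next
          case 2
          then have "commutator G (com (Gen i)) (com t) \<in> span (Suc k) {u. foliage u < foliage t}"
            using t i by (intro commutator_com_mem_span) simp_all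
          then have "commutator G (com (Gen i)) (com t) \<in> ?S"
            using span_mono[of "{u. foliage u < foliage t}" UNIV "Suc k"] by auto
          then show ?thesis
            using t i gens_closed[OF that] by (intro S.commutator_swap_mem[of "x i"]) simp_all
        next
          case 3
          then show ?thesis
            using gens_closed[OF that] by (simp add: commutator_self)
        qed
      qed
      then have "commutator G (com t) z \<in> ?S"
        using t z gens_closed gen by (intro S.commutator_generate_right[of "com t" "x ` {..<n}" z]) auto
      then show "commutator G z (com t) \<in> ?S"
        using t z by (intro S.commutator_swap_mem[of "com t"]) auto
    qed (use Suc y z S.normal_axioms lower_central_subset_span[of "Suc k"] in auto)
  qed (use y z in auto)
  then have "lower_central G (Suc k) \<subseteq> ?S"
    using Suc.hyps unfolding lower_central_Suc[OF Suc.hyps]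
    by (intro generate_subgroup_incl[OF _ S.subgroup_axioms]) auto
  then show ?case
    using span_subset by blast
qed

end

section \<open>Magnus coefficients\<close>

text \<open>A function on words is a power series in noncommuting variables; the generator \<open>x\<^sub>i\<close> of
  the free group is sent to \<open>1 + X\<^sub>i\<close>.\<close>

definition conv :: "(nat list \<Rightarrow> int) \<Rightarrow> (nat list \<Rightarrow> int) \<Rightarrow> nat list \<Rightarrow> int"
  where "conv f g w = (\<Sum>i\<le>length w. f (take i w) * g (drop i w))"

definition series_one :: "nat list \<Rightarrow> int"
  where "series_one w = (if w = [] then 1 else 0)"

text \<open>The second clause is the geometric series (1 + X)^-1 = 1 - X + X^2 - ...;
  \<open>set w \<subseteq> {i}\<close> says that \<open>w\<close> is a power of the letter
  \<open>i\<close>, possibly empty.\<close>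

fun letter_series :: "letter \<Rightarrow> nat list \<Rightarrow> int"
  where
    "letter_series (i, True) w = (if w = [] \<or> w = [i] then 1 else 0)"
  | "letter_series (i, False) w = (if set w \<subseteq> {i} then (-1) ^ length w else 0)"

definition magnus :: "letter list \<Rightarrow> nat list \<Rightarrow> int"
  where "magnus u = foldr (\<lambda>a. conv (letter_series a)) u series_one"

lemma conv_Nil [simp]: "conv f g [] = f [] * g []"
  by (simp add: conv_def)

lemma conv_Cons: "conv f g (a # w) = f [] * g (a # w) + conv (\<lambda>u. f (a # u)) g w"
  unfolding conv_def by (simp add: sum.atMost_Suc_shift del: sum.atMost_Suc)

lemma conv_add_left: "conv (\<lambda>u. f u + g u) h w = conv f h w + conv g h w"
  by (simp add: conv_def distrib_right sum.distrib)

lemma conv_scale_left: "conv (\<lambda>u. c * f u) g w = c * conv f g w"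
  by (simp add: conv_def sum_distrib_left mult.assoc)

lemma conv_assoc_apply: "conv (conv f g) h w = conv f (conv g h) w"
  by (induction w arbitrary: f)
    (simp_all add: conv_Cons conv_add_left conv_scale_left distrib_left)

lemma conv_assoc: "conv (conv f g) h = conv f (conv g h)"
  by (rule ext) (rule conv_assoc_apply)

lemma conv_zero_left [simp]: "conv (\<lambda>_. 0) g w = 0"
  by (simp add: conv_def)

lemma conv_one_left [simp]: "conv series_one f = f"
proof
  show "conv series_one f w = f w" for w
    by (cases w) (simp_all add: conv_Cons series_one_def)
qed

lemma letter_series_inverse:
  "conv (letter_series (i, True)) (letter_series (i, False)) w = series_one w"
  "conv (letter_series (i, False)) (letter_series (i, True)) w = series_one w"
proof -
  show "conv (letter_series (i, True)) (letter_series (i, False)) w = series_one w"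
  proof (cases w)
    case (Cons a v)
    have "(\<lambda>u. letter_series (i, True) (a # u)) = (\<lambda>u. (if a = i then 1 else 0) * series_one u)"
      by (auto simp: series_one_def)
    then show ?thesis
      by (simp add: Cons conv_Cons conv_scale_left) (simp add: series_one_def)
  qed (simp add: series_one_def)
  show "conv (letter_series (i, False)) (letter_series (i, True)) w = series_one w"
  proof (induction w)
    case (Cons a v)
    have "(\<lambda>u. letter_series (i, False) (a # u)) =
        (\<lambda>u. (if a = i then -1 else 0) * letter_series (i, False) u)"
      by auto
    then show ?case
      by (simp only: conv_Cons conv_scale_left Cons) (simp add: series_one_def)
  qed (simp add: series_one_def)
qed

lemma conv_letter_series_inv_letter:
  "conv (letter_series a) (conv (letter_series (inv_letter a)) f) = f"
proof -
  have "conv (letter_series a) (letter_series (inv_letter a)) = series_one"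
    by (cases a; cases "snd a") (auto simp: inv_letter_def letter_series_inverse)
  then show ?thesis
    by (simp flip: conv_assoc)
qed

lemma magnus_empty [simp]: "magnus [] = series_one"
  by (simp add: magnus_def)

lemma magnus_Cons: "magnus (a # u) = conv (letter_series a) (magnus u)"
  by (simp add: magnus_def)

lemma magnus_push: "magnus (push a u) = conv (letter_series a) (magnus u)"
  by (cases u) (auto simp: magnus_Cons conv_letter_series_inv_letter)

lemma magnus_foldr_push: "magnus (foldr push u v) = conv (magnus u) (magnus v)"
  by (induction u) (simp_all add: magnus_push magnus_Cons conv_assoc)

lemma letter_series_Nil [simp]: "letter_series a [] = 1"
  by (cases a; cases "snd a") auto

lemma magnus_Nil [simp]: "magnus u [] = 1"
  by (induction u) (simp_all add: magnus_Cons series_one_def)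

section \<open>Lowest-degree terms of products, commutators and inverses\<close>

text \<open>The empty word is exempt because Magnus series have constant term 1; for such
  \<open>f\<close> this says that f - 1 has order at least \<open>k\<close>.\<close>

definition vanishes_below :: "nat \<Rightarrow> (nat list \<Rightarrow> int) \<Rightarrow> bool"
  where "vanishes_below k f \<longleftrightarrow> (\<forall>w. w \<noteq> [] \<longrightarrow> length w < k \<longrightarrow> f w = 0)"

lemma vanishes_below_1 [simp]: "vanishes_below (Suc 0) f"
  by (simp add: vanishes_below_def)

text \<open>In (1 + f')(1 + g') = 1 + f' + g' + f' g', the last product starts in degree a + b,
  where only the split after \<open>a\<close> letters contributes.\<close>

lemma conv_low_degree:
  assumes "f [] = 1" "g [] = 1" "vanishes_below a f" "vanishes_below b g" "1 \<le> a" "1 \<le> b"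
    and "w \<noteq> []" "length w \<le> a + b"
  shows "conv f g w = f w + g w + (if length w = a + b then f (take a w) * g (drop a w) else 0)"
proof -
  let ?t = "\<lambda>i. f (take i w) * g (drop i w)"
  \<comment> \<open>A split before \<open>a\<close> kills the left factor; a later one leaves fewer
    than \<open>b\<close> letters on the right, unless it is at \<open>a\<close> and
    \<open>w\<close> has full length.\<close>
  have mid: "?t i = (if i = a \<and> length w = a + b then ?t a else 0)" if "i \<in> {1..<length w}" for i
  proof (cases "i < a")
    case True
    then show ?thesis
      using that assms(3,7) by (auto simp: vanishes_below_def)
  next
    case False
    then show ?thesis
      using that assms(4,8) by (auto simp: vanishes_below_def)
  qed
  have "{..length w} = insert 0 (insert (length w) {1..<length w})"
    using assms(7) by (auto simp: Suc_le_eq)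
  then have "conv f g w = ?t 0 + (?t (length w) + (\<Sum>i\<in>{1..<length w}. ?t i))"
    using assms(7) by (simp add: conv_def)
  also have "(\<Sum>i\<in>{1..<length w}. ?t i) =
      (\<Sum>i\<in>{1..<length w}. if i = a \<and> length w = a + b then ?t a else 0)"
    using mid by (rule sum.cong[OF refl])
  also have "\<dots> = (if length w = a + b then ?t a else 0)"
    using assms(5,6) by (auto simp: sum.delta)
  finally show ?thesis
    using assms(1,2) by simp
qed

lemma conv_eq_add:
  assumes "f [] = 1" "g [] = 1" "vanishes_below k f" "vanishes_below k g" "1 \<le> k"
    and "w \<noteq> []" "length w \<le> k"
  shows "conv f g w = f w + g w"
  using conv_low_degree[OF assms(1-5,5,6)] assms(5,7) by simp

context
  fixes n :: nat
begin

interpretation F: group "free_group n"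
  by (rule group_free_group)

lemma magnus_mult: "magnus (u \<otimes>\<^bsub>free_group n\<^esub> v) = conv (magnus u) (magnus v)"
  by (simp add: free_group_def magnus_foldr_push)

lemma magnus_one: "magnus \<one>\<^bsub>free_group n\<^esub> = series_one"
  by (simp add: free_group_def)

text \<open>The leading term is the Lie bracket of the leading terms. It is found by comparing
  coefficients in [g, h] (h g) = g h, which avoids expanding the series of inverses.\<close>

lemma magnus_commutator:
  assumes "g \<in> carrier (free_group n)" "h \<in> carrier (free_group n)" "1 \<le> a" "1 \<le> b"
    and "vanishes_below a (magnus g)" "vanishes_below b (magnus h)"
  shows "vanishes_below (a + b) (magnus (commutator (free_group n) g h))"
    and "length w = a + b \<Longrightarrow> magnus (commutator (free_group n) g h) w =
      magnus g (take a w) * magnus h (drop a w) - magnus h (take b w) * magnus g (drop b w)"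
proof -
  let ?K = "magnus (commutator (free_group n) g h)"
  have eq: "conv ?K (conv (magnus h) (magnus g)) = conv (magnus g) (magnus h)"
    using F.commutator_mult_swap[OF assms(1,2)] by (metis magnus_mult)
  \<comment> \<open>If \<open>?K\<close> has no terms below the degree of \<open>w\<close>, its
    product with the series of h g has at \<open>w\<close> the sum of the two coefficients; the
    second series is given the vacuous order 1.\<close>
  have K: "?K w = conv (magnus g) (magnus h) w - conv (magnus h) (magnus g) w"
    if "vanishes_below (length w) ?K" "w \<noteq> []" for w
    using conv_low_degree[of ?K "conv (magnus h) (magnus g)" "length w" 1 w] that
    by (simp add: eq Suc_le_eq)
  have gh: "conv (magnus g) (magnus h) w = magnus g w + magnus h w +
      (if length w = a + b then magnus g (take a w) * magnus h (drop a w) else 0)"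
    and hg: "conv (magnus h) (magnus g) w = magnus h w + magnus g w +
      (if length w = a + b then magnus h (take b w) * magnus g (drop b w) else 0)"
    if "w \<noteq> []" "length w \<le> a + b" for w
    using that assms by (simp_all add: conv_low_degree add.commute)
  \<comment> \<open>Below degree a + b the series of g h and h g agree, which forces the
    coefficients of \<open>?K\<close> to vanish one degree at a time.\<close>
  have van: "vanishes_below m ?K" if "m \<le> a + b" for m
    using that
  proof (induction m)
    case (Suc m)
    have "?K w = 0" if "w \<noteq> []" "length w = m" for w
      using K[of w] gh[of w] hg[of w] that Suc by simp
    then show ?case
      using Suc by (auto simp: vanishes_below_def less_Suc_eq)
  qed (simp add: vanishes_below_def)
  show "vanishes_below (a + b) ?K"
    by (rule van) simp
  show "?K w = magnus g (take a w) * magnus h (drop a w) - magnus h (take b w) * magnus g (drop b w)"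
    if "length w = a + b"
  proof -
    have "w \<noteq> []"
      using that assms(3) by auto
    then show ?thesis
      using that K[OF van] gh hg by simp
  qed
qed

lemma vanishes_below_conv:
  assumes "f [] = 1" "g [] = 1" "vanishes_below k f" "vanishes_below k g"
  shows "vanishes_below k (conv f g)"
proof (cases "1 \<le> k")
  case True
  then show ?thesis
    using conv_eq_add[OF assms] assms by (simp add: vanishes_below_def)
qed (simp add: vanishes_below_def)

lemma magnus_inv:
  assumes "g \<in> carrier (free_group n)" "vanishes_below k (magnus g)" "w \<noteq> []" "length w \<le> k"
  shows "magnus (inv\<^bsub>free_group n\<^esub> g) w = - magnus g w"
  using assms(3,4)
proof (induction "length w" arbitrary: w rule: less_induct)
  case less
  let ?g' = "magnus (inv\<^bsub>free_group n\<^esub> g)"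
  have "?g' v = 0" if "v \<noteq> []" "length v < length w" for v
    using less that assms(2) by (simp add: vanishes_below_def)
  then have "vanishes_below (length w) ?g'" "vanishes_below (length w) (magnus g)"
    using assms(2) less.prems by (simp_all add: vanishes_below_def)
  then have "conv ?g' (magnus g) w = ?g' w + magnus g w"
    using less.prems by (intro conv_eq_add[where k = "length w"]) (simp_all add: Suc_le_eq)
  moreover have "conv ?g' (magnus g) = series_one"
    using F.l_inv[OF assms(1)] by (metis magnus_mult magnus_one)
  ultimately show ?case
    using less.prems by (simp add: series_one_def)
qed

lemma vanishes_below_subgroup:
  "subgroup {g \<in> carrier (free_group n). vanishes_below k (magnus g)} (free_group n)"
proof (rule F.subgroupI)
  show "{g \<in> carrier (free_group n). vanishes_below k (magnus g)} \<noteq> {}"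
    by (auto intro!: exI[of _ "\<one>\<^bsub>free_group n\<^esub>"] simp: magnus_one vanishes_below_def series_one_def split: if_splits)
qed (auto simp: magnus_mult vanishes_below_conv, auto simp: vanishes_below_def magnus_inv)

text \<open>Every series has order at least 1 in the sense of \<open>vanishes_below\<close>, so a
  commutator with an arbitrary element raises the order by one.\<close>

lemma vanishes_below_lower_central:
  "1 \<le> k \<Longrightarrow> g \<in> lower_central (free_group n) k \<Longrightarrow> vanishes_below k (magnus g)"
proof (induction k arbitrary: g rule: nat_induct_at_least)
  case (Suc k)
  have "lower_central (free_group n) (Suc k) \<subseteq>
      {g \<in> carrier (free_group n). vanishes_below (Suc k) (magnus g)}"
    unfolding F.lower_central_Suc[OF Suc.hyps]
  proof (rule F.generate_subgroup_incl[OF _ vanishes_below_subgroup], clarify)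
    fix x y assume "x \<in> lower_central (free_group n) k" "y \<in> carrier (free_group n)"
    then show "commutator (free_group n) x y \<in> carrier (free_group n) \<and>
        vanishes_below (Suc k) (magnus (commutator (free_group n) x y))"
      using magnus_commutator(1)[of x y k 1] Suc by simp
  qed
  then show ?case
    using Suc.prems by blast
qed simp

section \<open>Leading words of Lyndon commutators\<close>

lemma free_gen_closed: "i < n \<Longrightarrow> free_gen i \<in> carrier (free_group n)"
  by (simp add: free_gen_def free_group_def reduced_def)

interpretation F: group_gens "free_group n" free_gen n
  by unfold_locales (rule free_gen_closed)

lemma magnus_free_gen: "magnus (free_gen i) w = (if w = [] \<or> w = [i] then 1 else 0)"
proof -
  have "conv (letter_series (i, True)) series_one w = letter_series (i, True) w"
    by (simp add: conv_def series_one_def if_distrib[of "(*) _"] sum.delta cong: if_cong)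
  then show ?thesis
    by (simp add: free_gen_def magnus_Cons)
qed

text \<open>Triangularity. In the bracket of the leading terms of \<open>s\<close> and
  \<open>t\<close>, the product in the order t, s involves only words from
  \<open>foliage t @ foliage s\<close> upwards, which exceed the word of the tree; the other product
  starts exactly at that word.\<close>

lemma magnus_lyndon_commutator:
  assumes "lyndon_tree n t" "length w = length (foliage t)" "w \<le> foliage t"
  shows "magnus (F.com t) w = (if w = foliage t then 1 else 0)"
  using assms
proof (induction t arbitrary: w)
  case (Gen i)
  then show ?case
    by (auto simp: magnus_free_gen)
next
  case (Br s t)
  let ?a = "length (foliage s)" and ?b = "length (foliage t)"
  have s: "lyndon_tree n s" and t: "lyndon_tree n t" and st: "foliage s < foliage t"
    using Br.prems by auto
  have len: "length w = ?a + ?b"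
    using Br.prems by simp
  have pos: "1 \<le> ?a" "1 \<le> ?b"
    by (simp_all add: Suc_le_eq)
  have eq: "magnus (F.com (Br s t)) w =
      magnus (F.com s) (take ?a w) * magnus (F.com t) (drop ?a w) -
      magnus (F.com t) (take ?b w) * magnus (F.com s) (drop ?b w)"
    using magnus_commutator(2)[OF _ _ pos _ _ len] s t pos
      vanishes_below_lower_central[OF pos(1) F.com_mem[OF s]]
      vanishes_below_lower_central[OF pos(2) F.com_mem[OF t]] by simp
  have le: "take ?a w @ drop ?a w \<le> foliage s @ foliage t"
    using Br.prems by simp
  have take_a: "take ?a w \<le> foliage s"
    by (rule append_less_appendD[OF _ le]) (simp add: len)
  \<comment> \<open>The word \<open>foliage t\<close> lies strictly between: a Lyndon word is below
    its proper suffix, and a word is below its proper extensions.\<close>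
  have "foliage s @ foliage t < foliage t @ foliage s"
    using order.strict_trans[OF _ less_append_right[of "foliage s" "foliage t"]]
      lyndon_tree_Br_less[OF Br.prems(1)] by simp
  then have lt: "take ?b w @ drop ?b w < foliage t @ foliage s"
    using Br.prems(3) by simp
  have take_b: "take ?b w \<le> foliage t"
    by (rule append_less_appendD[OF _ less_imp_le[OF lt]]) (simp add: len)
  \<comment> \<open>Since \<open>w\<close> is below \<open>foliage t @ foliage s\<close>, one of its
    two blocks is below the least word of the corresponding factor.\<close>
  have "magnus (F.com t) (take ?b w) * magnus (F.com s) (drop ?b w) = 0"
  proof (cases "take ?b w = foliage t")
    case True
    then have "drop ?b w < foliage s"
      using lt by simp
    then show ?thesis
      using Br.IH(1)[OF s, of "drop ?b w"] len by simp
  next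
    case False
    then show ?thesis
      using Br.IH(2)[OF t, of "take ?b w"] take_b len by simp
  qed
  moreover have "magnus (F.com s) (take ?a w) * magnus (F.com t) (drop ?a w) =
      (if w = foliage s @ foliage t then 1 else 0)"
  proof (cases "take ?a w = foliage s")
    case True
    then have w: "w = foliage s @ drop ?a w"
      by (metis append_take_drop_id)
    then have "drop ?a w \<le> foliage t"
      using le True by (metis append_le_append_iff)
    then show ?thesis
      using Br.IH(1)[OF s, of "foliage s"] Br.IH(2)[OF t, of "drop ?a w"] len True w
      by (metis (no_types, lifting) add_diff_cancel_left' append_eq_append_conv length_drop mult_1 order_refl same_append_eq)
  next
    case False
    then show ?thesis
      using Br.IH(1)[OF s, of "take ?a w"] take_a len by auto
  qed
  ultimately show ?case
    using eq by simp
qed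

section \<open>Elimination by degree-k coefficients\<close>

lemma lower_central_magnus_add:
  assumes "1 \<le> k" "g \<in> lower_central (free_group n) k" "h \<in> lower_central (free_group n) k" "length w = k"
  shows "magnus (g \<otimes>\<^bsub>free_group n\<^esub> h) w = magnus g w + magnus h w"
proof -
  have "w \<noteq> []"
    using assms by auto
  then show ?thesis
    using conv_eq_add[of "magnus g" "magnus h" k w] assms vanishes_below_lower_central
    by (simp add: magnus_mult)
qed

lemma lower_central_magnus_inv:
  assumes "1 \<le> k" "g \<in> lower_central (free_group n) k" "length w = k"
  shows "magnus (inv\<^bsub>free_group n\<^esub> g) w = - magnus g w"
proof -
  have "w \<noteq> []"
    using assms by auto
  then show ?thesis
    using magnus_inv[OF _ vanishes_below_lower_central[OF assms(1,2)]] assms by simp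
qed

lemma lower_central_magnus_pow:
  assumes "1 \<le> k" "g \<in> lower_central (free_group n) k" "length w = k"
  shows "magnus (g [^]\<^bsub>free_group n\<^esub> (m :: int)) w = m * magnus g w"
proof -
  interpret S: normal "lower_central (free_group n) k" "free_group n"
    by (rule F.lower_central_normal)
  have pow: "g [^]\<^bsub>free_group n\<^esub> (j :: nat) \<in> lower_central (free_group n) k \<and>
      magnus (g [^]\<^bsub>free_group n\<^esub> j) w = int j * magnus g w" for j
  proof (induction j)
    case 0
    then show ?case
      using assms(1,3) magnus_one by (auto simp: series_one_def)
  next
    case (Suc j)
    then show ?case
      using assms by (simp add: lower_central_magnus_add distrib_right)
  qed
  show ?thesis
  proof (cases "0 \<le> m")
    case True
    then have "g [^]\<^bsub>free_group n\<^esub> m = g [^]\<^bsub>free_group n\<^esub> nat m"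
      using int_pow_int[of "free_group n" g "nat m"] by (simp only: int_nat_eq if_True)
    then show ?thesis
      using pow[of "nat m"] True by simp
  next
    case False
    then have "g [^]\<^bsub>free_group n\<^esub> m = inv\<^bsub>free_group n\<^esub> (g [^]\<^bsub>free_group n\<^esub> nat (- m))"
      by (simp only: int_pow_def2 not_le if_True)
    then show ?thesis
      using pow[of "nat (- m)"] lower_central_magnus_inv[OF assms(1) _ assms(3)] False by simp
  qed
qed

lemma lower_central_Suc_magnus:
  assumes "1 \<le> k" "g \<in> lower_central (free_group n) (Suc k)" "length w = k"
  shows "magnus g w = 0"
proof -
  have "w \<noteq> []"
    using assms by auto
  then show ?thesis
    using vanishes_below_lower_central[OF _ assms(2)] assms(3) by (simp add: vanishes_below_def)
qed

text \<open>By triangularity every Lyndon generator of the span has coefficient zero at a word below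
  its foliage, and the vanishing of one degree-\<open>k\<close> coefficient defines a subgroup of
  \<gamma>_k.\<close>

lemma span_magnus_eq_0:
  assumes "1 \<le> k" "\<And>t. t \<in> T \<Longrightarrow> w < foliage t" "length w = k" "g \<in> F.span k T"
  shows "magnus g w = 0"
proof -
  let ?Z = "{g \<in> lower_central (free_group n) k. magnus g w = 0}"
  interpret S: normal "lower_central (free_group n) k" "free_group n"
    by (rule F.lower_central_normal)
  have "subgroup ?Z (free_group n)"
  proof (rule F.subgroupI)
    have "\<one>\<^bsub>free_group n\<^esub> \<in> ?Z"
      using assms(1,3) S.one_closed by (auto simp: magnus_one series_one_def simp del: S.one_closed)
    then show "?Z \<noteq> {}"
      by blast
  qed (use assms in \<open>auto simp: lower_central_magnus_add lower_central_magnus_inv\<close>)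
  moreover have "F.com ` {t \<in> T. lyndon_tree n t \<and> length (foliage t) = k} \<union>
      lower_central (free_group n) (Suc k) \<subseteq> ?Z"
  proof -
    have "magnus (F.com t) w = 0" if "t \<in> T" "lyndon_tree n t" "length (foliage t) = k" for t
      using magnus_lyndon_commutator[OF that(2), of w] assms(2)[OF that(1)] assms(3) that(3) by auto
    then show ?thesis
      using F.span_gens_subset[of T k] lower_central_Suc_magnus[OF assms(1) _ assms(3)] by auto
  qed
  ultimately have "F.span k T \<subseteq> ?Z"
    unfolding lyndon_span_def by (rule F.generate_subgroup_incl[rotated])
  then show ?thesis
    using assms(4) by blast
qed

text \<open>Normality of \<open>F.span k T\<close> makes its product with the cyclic group of
  \<open>F.com t\<close> a subgroup, and this subgroup contains all generators of the larger
  span.\<close>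

lemma span_insert:
  assumes "1 \<le> k" "lyndon_tree n t" "length (foliage t) = k" "g \<in> F.span k (insert t T)"
  obtains m :: int and h where "h \<in> F.span k T" "g = F.com t [^]\<^bsub>free_group n\<^esub> m \<otimes>\<^bsub>free_group n\<^esub> h"
proof -
  interpret N: normal "F.span k T" "free_group n"
    by (rule F.span_normal[OF assms(1)])
  let ?C = "generate (free_group n) {F.com t}"
  have t: "F.com t \<in> carrier (free_group n)"
    using assms(2) by simp
  have C: "subgroup ?C (free_group n)"
    using t by (intro F.generate_is_subgroup) simp
  have CN: "subgroup (?C <#>\<^bsub>free_group n\<^esub> F.span k T) (free_group n)"
    using F.mult_norm_subgroup[OF N.normal_axioms C] F.commut_normal[OF C N.normal_axioms] by simp
  have one: "\<one>\<^bsub>free_group n\<^esub> \<in> ?C"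
    by (rule generate.one)
  have "F.span k T \<subseteq> ?C <#>\<^bsub>free_group n\<^esub> F.span k T"
    using one N.subset unfolding set_mult_def by force
  moreover have "F.com t \<in> ?C <#>\<^bsub>free_group n\<^esub> F.span k T"
    using t generate.incl[of "F.com t" "{F.com t}" "free_group n"] unfolding set_mult_def
    by (force intro: bexI[of _ "\<one>\<^bsub>free_group n\<^esub>"])
  ultimately have "F.com ` {s \<in> insert t T. lyndon_tree n s \<and> length (foliage s) = k} \<union>
      lower_central (free_group n) (Suc k) \<subseteq> ?C <#>\<^bsub>free_group n\<^esub> F.span k T"
    using F.com_in_span[of _ T k] F.lower_central_subset_span[of k T] by blast
  then have "F.span k (insert t T) \<subseteq> ?C <#>\<^bsub>free_group n\<^esub> F.span k T"
    using CN unfolding lyndon_span_def[of _ _ _ _ "insert t T"] by (rule F.generate_subgroup_incl)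
  then have "g \<in> ?C <#>\<^bsub>free_group n\<^esub> F.span k T"
    using assms(4) by (rule subsetD)
  then obtain c h where "c \<in> ?C" "h \<in> F.span k T" "g = c \<otimes>\<^bsub>free_group n\<^esub> h"
    unfolding set_mult_def by blast
  then show thesis
    using that unfolding F.generate_pow[OF t] by blast
qed

lemma span_magnus_kernel:
  assumes "1 \<le> k" "finite T" "\<And>t. t \<in> T \<Longrightarrow> lyndon_tree n t \<and> length (foliage t) = k"
    and "g \<in> F.span k T" "\<And>t. t \<in> T \<Longrightarrow> magnus g (foliage t) = 0"
  shows "g \<in> lower_central (free_group n) (Suc k)"
  using assms(2-)
proof (induction T rule: finite_psubset_induct)
  case (psubset T)
  show ?case
  proof (cases "T = {}")
    case True
    have "F.span k {} \<subseteq> lower_central (free_group n) (Suc k)"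
      unfolding lyndon_span_def
      by (rule F.generate_subgroup_incl[OF _ normal_imp_subgroup[OF F.lower_central_normal]]) simp
    then show ?thesis
      using psubset.prems True by blast
  next
    case False
    then have "Min (foliage ` T) \<in> foliage ` T"
      using psubset.hyps by (intro Min_in) auto
    then obtain t where t: "t \<in> T" "foliage t = Min (foliage ` T)"
      by force
    have ly: "lyndon_tree n t" "length (foliage t) = k"
      using psubset.prems(1)[OF t(1)] by auto
    have less: "foliage t < foliage s" if "s \<in> T - {t}" for s
    proof -
      have "foliage t \<le> foliage s"
        using that t(2) psubset.hyps by simp
      moreover have "foliage t \<noteq> foliage s"
        using foliage_inj[OF ly(1), of s] psubset.prems(1)[of s] that by auto
      ultimately show ?thesis
        by simp
    qed
    have "g \<in> F.span k (insert t (T - {t}))"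
      using psubset.prems(2) t(1) by (simp add: insert_absorb)
    then obtain m h where h: "h \<in> F.span k (T - {t})"
      "g = F.com t [^]\<^bsub>free_group n\<^esub> (m :: int) \<otimes>\<^bsub>free_group n\<^esub> h"
      by (rule span_insert[OF assms(1) ly])
    have ct: "F.com t \<in> lower_central (free_group n) k"
      using F.com_mem[OF ly(1)] ly(2) by simp
    interpret S: normal "lower_central (free_group n) k" "free_group n"
      by (rule F.lower_central_normal)
    have "F.com t [^]\<^bsub>free_group n\<^esub> m \<in> lower_central (free_group n) k"
      by (rule F.subgroup_int_pow_closed[OF S.subgroup_axioms ct])
    moreover have hk: "h \<in> lower_central (free_group n) k"
      using F.span_subset h(1) by blast
    moreover have "magnus h (foliage t) = 0"
      by (rule span_magnus_eq_0[OF assms(1) less ly(2) h(1)])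
    ultimately have "magnus g (foliage t) = m"
      using magnus_lyndon_commutator[OF ly(1), of "foliage t"] ly(2) assms(1) ct h(2)
      by (simp add: lower_central_magnus_add lower_central_magnus_pow)
    then have "m = 0"
      using psubset.prems(3)[OF t(1)] by simp
    then have "g = h"
      using h(2) hk by simp
    then show ?thesis
      using psubset.IH[of "T - {t}"] psubset.prems h(1) t(1) by blast
  qed
qed

text \<open>Within \<gamma>_k this is the converse of \<open>lower_central_Suc_magnus\<close>.
  Elimination over all Lyndon trees with \<open>k\<close> leaves is possible because
  \<open>foliage\<close> embeds them into the finite set of words of length
  \<open>k\<close>.\<close>

theorem lower_central_magnus_kernel:
  assumes "1 \<le> k" "g \<in> lower_central (free_group n) k"
    and "\<And>w. set w \<subseteq> {..<n} \<Longrightarrow> length w = k \<Longrightarrow> magnus g w = 0"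
  shows "g \<in> lower_central (free_group n) (Suc k)"
proof (rule span_magnus_kernel[OF assms(1)])
  let ?T = "{t. lyndon_tree n t \<and> length (foliage t) = k}"
  have "finite (foliage ` ?T)"
    by (rule finite_subset[OF _ finite_lists_length_eq[of "{..<n}" k]]) (use set_foliage in auto)
  moreover have "inj_on foliage ?T"
    using foliage_inj by (auto intro: inj_onI)
  ultimately show "finite ?T"
    by (rule finite_imageD)
  have "F.span k ?T = F.span k UNIV"
    by (simp add: lyndon_span_def)
  then show "g \<in> F.span k ?T"
    using F.lower_central_eq_span[OF free_group_generated assms(1)] assms(2) by simp
  show "magnus g (foliage t) = 0" if "t \<in> ?T" for t
    using assms(3) set_foliage that by blast
qed simp

end

section \<open>The Magnus map into the tensor powers\<close>

text \<open>Tensoring with fixed vectors on both sides, on representatives in the free Abelian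
  group.\<close>

definition append_tensor :: "'a list \<Rightarrow> 'a list \<Rightarrow> ('a list \<Rightarrow>\<^sub>0 int) \<Rightarrow> 'a list \<Rightarrow>\<^sub>0 int"
  where "append_tensor us vs = frag_extend (\<lambda>xs. frag_of (us @ xs @ vs))"

context
  fixes A :: "('a, 'b) monoid_scheme"
  assumes A: "group A"
begin

interpretation R: normal "tensor_relations A k" "free_Abelian_group (tensor_tuples A k)" for k
  by (rule tensor_relations_normal[OF A])

lemma tensor_relations_add:
  "r \<in> tensor_relations A k \<Longrightarrow> s \<in> tensor_relations A k \<Longrightarrow> r + s \<in> tensor_relations A k"
  using subgroup.m_closed[OF R.subgroup_axioms, of r k s] by simp

lemma tensor_relations_zero: "0 \<in> tensor_relations A k"
  using subgroup.one_closed[OF R.subgroup_axioms, of k] by simp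

lemma tensor_relations_minus: "r \<in> tensor_relations A k \<Longrightarrow> - r \<in> tensor_relations A k"
  using subgroup.m_inv_closed[OF R.subgroup_axioms, of r k] R.mem_carrier[of r k]
  by (metis carrier_free_Abelian_group_iff inv_free_Abelian_group)

lemma tensor_relations_diff:
  "r \<in> tensor_relations A k \<Longrightarrow> s \<in> tensor_relations A k \<Longrightarrow> r - s \<in> tensor_relations A k"
  using tensor_relations_add[OF _ tensor_relations_minus, of r k s] by simp

lemma tensor_relations_cmul: "r \<in> tensor_relations A k \<Longrightarrow> frag_cmul c r \<in> tensor_relations A k"
  using frag_closure_minus_cmul[of "\<lambda>r. r \<in> tensor_relations A k"]
    tensor_relations_zero tensor_relations_diff by blast

lemma tensor_relations_sum:
  "(\<And>i. i \<in> I \<Longrightarrow> f i \<in> tensor_relations A k) \<Longrightarrow> sum f I \<in> tensor_relations A k"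
  by (induction I rule: infinite_finite_induct) (auto simp: tensor_relations_zero tensor_relations_add)

text \<open>\<open>S\<close> is given by closure properties so that it can be another relation
  subgroup as well as \<open>{0}\<close>.\<close>

lemma frag_extend_tensor_relations:
  assumes "r \<in> tensor_relations A k" "frag_extend f ` tensor_relators A k \<subseteq> S"
    and "0 \<in> S" "\<And>x y. x \<in> S \<Longrightarrow> y \<in> S \<Longrightarrow> x + y \<in> S" "\<And>x. x \<in> S \<Longrightarrow> - x \<in> S"
  shows "frag_extend f r \<in> S"
  using assms(1) unfolding tensor_relations_def
proof (induction rule: generate.induct)
  case (inv r)
  then have "Poly_Mapping.keys r \<subseteq> tensor_tuples A k"
    using tensor_relators_subset[OF A, of k] by (auto simp del: carrier_free_Abelian_group_iff simp: carrier_free_Abelian_group_iff[symmetric])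
  then show ?case
    using inv assms by (auto simp: frag_extend_minus)
qed (use assms in \<open>auto simp: frag_extend_add\<close>)

lemma append_tensor_relations:
  assumes "r \<in> tensor_relations A k" "set us \<subseteq> carrier A" "set vs \<subseteq> carrier A"
  shows "append_tensor us vs r \<in> tensor_relations A (length us + k + length vs)"
  unfolding append_tensor_def
proof (rule frag_extend_tensor_relations[OF assms(1)])
  let ?f = "frag_extend (\<lambda>xs. frag_of (us @ xs @ vs))"
  show "?f ` tensor_relators A k \<subseteq> tensor_relations A (length us + k + length vs)"
  proof clarify
    fix r assume "r \<in> tensor_relators A k"
    then obtain as x y bs where xy: "as @ x # bs \<in> tensor_tuples A k" "y \<in> carrier A"
      and r: "r = frag_of (as @ (x \<otimes>\<^bsub>A\<^esub> y) # bs) - frag_of (as @ x # bs) - frag_of (as @ y # bs)"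
      unfolding tensor_relators_def by blast
    have "?f r = frag_of ((us @ as) @ (x \<otimes>\<^bsub>A\<^esub> y) # (bs @ vs)) -
        frag_of ((us @ as) @ x # (bs @ vs)) - frag_of ((us @ as) @ y # (bs @ vs))"
      by (simp add: r frag_extend_diff)
    moreover have "(us @ as) @ x # (bs @ vs) \<in> tensor_tuples A (length us + k + length vs)"
      using xy(1) assms(2,3) by (auto simp: tensor_tuples_def)
    ultimately have "?f r \<in> tensor_relators A (length us + k + length vs)"
      unfolding tensor_relators_def using xy(2) by blast
    then show "?f r \<in> tensor_relations A (length us + k + length vs)"
      unfolding tensor_relations_def by (rule generate.incl)
  qed
qed (auto simp: tensor_relations_zero tensor_relations_add tensor_relations_minus)

end

lemma frag_cmul_diff_right: "frag_cmul c (a - b) = frag_cmul c a - frag_cmul c b"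
  by (rule poly_mapping_eqI) (simp add: lookup_minus right_diff_distrib)

context
  fixes n :: nat
begin

interpretation F: group "free_group n"
  by (rule group_free_group)

interpretation N: normal "lower_central (free_group n) 2" "free_group n"
  by (rule F.lower_central_normal)

abbreviation "ab \<equiv> abelianization (free_group n)"

definition ab_class :: "letter list \<Rightarrow> letter list set"
  where "ab_class g = lower_central (free_group n) 2 #>\<^bsub>free_group n\<^esub> g"

abbreviation "ab_gen i \<equiv> ab_class (free_gen i)"

abbreviation "index_words k \<equiv> {w. set w \<subseteq> {..<n} \<and> length w = k}"

text \<open>The degree-\<open>k\<close> part of the Magnus series, with each variable read as the
  class of its generator. As a representative it is exactly additive on \<gamma>_k, whereas the
  bracket rule and equivariance hold modulo \<open>tensor_relations\<close>.\<close>

definition magnus_tensor :: "nat \<Rightarrow> letter list \<Rightarrow> letter list set list \<Rightarrow>\<^sub>0 int"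
  where "magnus_tensor k g = (\<Sum>w\<in>index_words k. frag_cmul (magnus g w) (frag_of (map ab_gen w)))"

lemma group_ab: "group ab"
  unfolding abelianization_def by (rule N.factorgroup_is_group)

lemma ab_class_hom: "ab_class \<in> hom (free_group n) ab"
  unfolding abelianization_def ab_class_def[abs_def] by (rule N.r_coset_hom_Mod)

lemma carrier_ab: "carrier ab = ab_class ` carrier (free_group n)"
  unfolding abelianization_def carrier_FactGroup ab_class_def ..

lemma ab_class_closed [simp]: "g \<in> carrier (free_group n) \<Longrightarrow> ab_class g \<in> carrier ab"
  using carrier_ab by blast

lemma ab_class_mult:
  "g \<in> carrier (free_group n) \<Longrightarrow> h \<in> carrier (free_group n) \<Longrightarrow>
    ab_class (g \<otimes>\<^bsub>free_group n\<^esub> h) = ab_class g \<otimes>\<^bsub>ab\<^esub> ab_class h"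
  using ab_class_hom by (rule hom_mult)

lemma finite_index_words [simp]: "finite (index_words k)"
  by (rule finite_lists_length_eq) simp

lemma map_ab_gen_closed: "set w \<subseteq> {..<n} \<Longrightarrow> set (map ab_gen w) \<subseteq> carrier ab"
  using free_gen_closed by auto

lemma magnus_length_1:
  "g \<in> carrier (free_group n) \<Longrightarrow> h \<in> carrier (free_group n) \<Longrightarrow>
    magnus (g \<otimes>\<^bsub>free_group n\<^esub> h) [i] = magnus g [i] + magnus h [i]"
  using lower_central_magnus_add[of 1 g n h "[i]"] by simp

text \<open>The linear Magnus coefficients are the coordinates of a class in the abelianization. The
  defect \<open>D\<close> is additive in \<open>h\<close> modulo the relations and vanishes on the
  generators.\<close>

lemma tensor_expand:
  assumes h: "h \<in> carrier (free_group n)" and us: "set us \<subseteq> carrier ab" and vs: "set vs \<subseteq> carrier ab"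
  shows "frag_of (us @ ab_class h # vs) -
      (\<Sum>i<n. frag_cmul (magnus h [i]) (frag_of (us @ ab_gen i # vs)))
    \<in> tensor_relations ab (length us + Suc (length vs))"
proof -
  let ?R = "tensor_relations ab (length us + Suc (length vs))"
  define D where "D = (\<lambda>h. frag_of (us @ ab_class h # vs) -
      (\<Sum>i<n. frag_cmul (magnus h [i]) (frag_of (us @ ab_gen i # vs))))"
  have D_mult: "D (g \<otimes>\<^bsub>free_group n\<^esub> h) - D g - D h \<in> ?R"
    if gh: "g \<in> carrier (free_group n)" "h \<in> carrier (free_group n)" for g h
  proof -
    have "D (g \<otimes>\<^bsub>free_group n\<^esub> h) - D g - D h = frag_of (us @ (ab_class g \<otimes>\<^bsub>ab\<^esub> ab_class h) # vs) -
        frag_of (us @ ab_class g # vs) - frag_of (us @ ab_class h # vs)"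
      using gh by (simp add: D_def ab_class_mult magnus_length_1 frag_cmul_distrib sum.distrib)
    moreover have "us @ ab_class g # vs \<in> tensor_tuples ab (length us + Suc (length vs))"
      using us vs gh by (auto simp: tensor_tuples_def)
    ultimately have "D (g \<otimes>\<^bsub>free_group n\<^esub> h) - D g - D h \<in>
        tensor_relators ab (length us + Suc (length vs))"
      unfolding tensor_relators_def using ab_class_closed[OF gh(2)] by blast
    then show ?thesis
      unfolding tensor_relations_def by (rule generate.incl)
  qed
  \<comment> \<open>For the product of the identity with itself, \<open>D_mult\<close> says that
    minus this element is a relation.\<close>
  have D_1: "D \<one>\<^bsub>free_group n\<^esub> \<in> ?R"
    using tensor_relations_minus[OF group_ab D_mult[of "\<one>\<^bsub>free_group n\<^esub>" "\<one>\<^bsub>free_group n\<^esub>"]] by simp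
  have "subgroup {h \<in> carrier (free_group n). D h \<in> ?R} (free_group n)"
  proof (rule F.subgroupI)
    show "{h \<in> carrier (free_group n). D h \<in> ?R} \<noteq> {}"
      using D_1 by blast
  next
    fix g assume g: "g \<in> {h \<in> carrier (free_group n). D h \<in> ?R}"
    then have "D \<one>\<^bsub>free_group n\<^esub> - D g - D (inv\<^bsub>free_group n\<^esub> g) \<in> ?R"
      using D_mult[of g "inv\<^bsub>free_group n\<^esub> g"] by simp
    then have "D \<one>\<^bsub>free_group n\<^esub> - (D \<one>\<^bsub>free_group n\<^esub> - D g - D (inv\<^bsub>free_group n\<^esub> g)) - D g \<in> ?R"
      using D_1 g tensor_relations_diff[OF group_ab] by blast
    then show "inv\<^bsub>free_group n\<^esub> g \<in> {h \<in> carrier (free_group n). D h \<in> ?R}"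
      using g by (simp add: algebra_simps)
  next
    fix g h assume gh: "g \<in> {h \<in> carrier (free_group n). D h \<in> ?R}" "h \<in> {h \<in> carrier (free_group n). D h \<in> ?R}"
    then have "(D (g \<otimes>\<^bsub>free_group n\<^esub> h) - D g - D h) + D g + D h \<in> ?R"
      using D_mult by (intro tensor_relations_add[OF group_ab]) auto
    then show "g \<otimes>\<^bsub>free_group n\<^esub> h \<in> {h \<in> carrier (free_group n). D h \<in> ?R}"
      using gh by simp
  qed auto
  moreover have "free_gen ` {..<n} \<subseteq> {h \<in> carrier (free_group n). D h \<in> ?R}"
  proof -
    have "D (free_gen j) = 0" if "j < n" for j
    proof -
      have "(\<Sum>i<n. frag_cmul (magnus (free_gen j) [i]) (frag_of (us @ ab_gen i # vs))) =
          (\<Sum>i<n. if j = i then frag_of (us @ ab_gen i # vs) else 0)"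
        by (rule sum.cong) (auto simp: magnus_free_gen)
      then show ?thesis
        using that by (simp add: D_def sum.delta')
    qed
    then show ?thesis
      using free_gen_closed tensor_relations_zero[OF group_ab] by auto
  qed
  ultimately have "generate (free_group n) (free_gen ` {..<n}) \<subseteq> {h \<in> carrier (free_group n). D h \<in> ?R}"
    by (rule F.generate_subgroup_incl[rotated])
  then show ?thesis
    using h unfolding free_group_generated D_def by blast
qed

lemma index_words_Suc_append:
  "(\<Sum>w\<in>index_words (Suc k). f w) = (\<Sum>u\<in>index_words k. \<Sum>i<n. f (u @ [i]))"
proof -
  have "(\<Sum>w\<in>index_words (Suc k). f w) = (\<Sum>(u, i)\<in>index_words k \<times> {..<n}. f (u @ [i]))"
  proof (rule sum.reindex_bij_witness[where i = "\<lambda>(u, i). u @ [i]" and j = "\<lambda>w. (butlast w, last w)"])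
    fix w assume w: "w \<in> index_words (Suc k)"
    then have "w \<noteq> []"
      by auto
    moreover from this have "last w < n"
      using w last_in_set by blast
    ultimately show "(case (butlast w, last w) of (u, i) \<Rightarrow> u @ [i]) = w"
      "(butlast w, last w) \<in> index_words k \<times> {..<n}"
      "(case (butlast w, last w) of (u, i) \<Rightarrow> f (u @ [i])) = f w"
      using w by (auto dest: in_set_butlastD)
  qed auto
  then show ?thesis
    by (simp add: sum.cartesian_product)
qed

lemma index_words_Suc_Cons:
  "(\<Sum>w\<in>index_words (Suc k). f w) = (\<Sum>u\<in>index_words k. \<Sum>i<n. f (i # u))"
proof -
  have "(\<Sum>w\<in>index_words (Suc k). f w) = (\<Sum>(u, i)\<in>index_words k \<times> {..<n}. f (i # u))"
    by (rule sum.reindex_bij_witness[where i = "\<lambda>(u, i). i # u" and j = "\<lambda>w. (tl w, hd w)"])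
      (auto simp: length_Suc_conv)
  then show ?thesis
    by (simp add: sum.cartesian_product)
qed

lemma append_magnus_tensor:
  "append_tensor us vs (magnus_tensor k g) =
    (\<Sum>w\<in>index_words k. frag_cmul (magnus g w) (frag_of (us @ map ab_gen w @ vs)))"
  unfolding append_tensor_def magnus_tensor_def
  by (simp add: frag_extend_sum frag_extend_cmul o_def)

text \<open>\<open>magnus_commutator\<close> with second weight 1 gives the bracket in coordinates;
  \<open>tensor_expand\<close> reassembles the linear coefficients of \<open>h\<close> into
  \<open>ab_class h\<close>, in the last slot for one half and in the first for the other.\<close>

lemma magnus_tensor_commutator:
  assumes "1 \<le> k" "g \<in> lower_central (free_group n) k" "h \<in> carrier (free_group n)"
  shows "magnus_tensor (Suc k) (commutator (free_group n) g h) -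
      (append_tensor [] [ab_class h] (magnus_tensor k g) - append_tensor [ab_class h] [] (magnus_tensor k g))
    \<in> tensor_relations ab (Suc k)"
proof -
  have g: "g \<in> carrier (free_group n)"
    using assms(2) by simp
  have coeff: "magnus (commutator (free_group n) g h) w =
      magnus g (take k w) * magnus h (drop k w) - magnus h (take 1 w) * magnus g (drop 1 w)"
    if "w \<in> index_words (Suc k)" for w
    using magnus_commutator(2)[OF g assms(3,1) _ vanishes_below_lower_central[OF assms(1,2)], of 1 w] that
    by simp
  have "magnus_tensor (Suc k) (commutator (free_group n) g h) =
      (\<Sum>w\<in>index_words (Suc k). frag_cmul (magnus g (take k w) * magnus h (drop k w)) (frag_of (map ab_gen w))) -
      (\<Sum>w\<in>index_words (Suc k). frag_cmul (magnus h (take 1 w) * magnus g (drop 1 w)) (frag_of (map ab_gen w)))"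
    unfolding magnus_tensor_def sum_subtractf[symmetric]
    by (rule sum.cong[OF refl]) (simp only: coeff frag_cmul_diff_distrib)
  also have "(\<Sum>w\<in>index_words (Suc k). frag_cmul (magnus g (take k w) * magnus h (drop k w)) (frag_of (map ab_gen w))) =
      (\<Sum>u\<in>index_words k. frag_cmul (magnus g u) (\<Sum>i<n. frag_cmul (magnus h [i]) (frag_of (map ab_gen u @ ab_gen i # []))))"
    unfolding index_words_Suc_append frag_cmul_sum by (intro sum.cong refl) simp
  also have "(\<Sum>w\<in>index_words (Suc k). frag_cmul (magnus h (take 1 w) * magnus g (drop 1 w)) (frag_of (map ab_gen w))) =
      (\<Sum>u\<in>index_words k. frag_cmul (magnus g u) (\<Sum>i<n. frag_cmul (magnus h [i]) (frag_of ([] @ ab_gen i # map ab_gen u))))"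
    unfolding index_words_Suc_Cons frag_cmul_sum by (intro sum.cong refl) (simp add: mult.commute)
  finally have eq: "magnus_tensor (Suc k) (commutator (free_group n) g h) -
      (append_tensor [] [ab_class h] (magnus_tensor k g) - append_tensor [ab_class h] [] (magnus_tensor k g)) =
      (\<Sum>u\<in>index_words k. frag_cmul (magnus g u) (frag_of ([] @ ab_class h # map ab_gen u) -
        (\<Sum>i<n. frag_cmul (magnus h [i]) (frag_of ([] @ ab_gen i # map ab_gen u))))) -
      (\<Sum>u\<in>index_words k. frag_cmul (magnus g u) (frag_of (map ab_gen u @ ab_class h # []) -
        (\<Sum>i<n. frag_cmul (magnus h [i]) (frag_of (map ab_gen u @ ab_gen i # [])))))"
    unfolding append_magnus_tensor by (simp add: frag_cmul_diff_right sum_subtractf)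
  have terms: "frag_of ([] @ ab_class h # map ab_gen u) -
        (\<Sum>i<n. frag_cmul (magnus h [i]) (frag_of ([] @ ab_gen i # map ab_gen u))) \<in> tensor_relations ab (Suc k)"
      "frag_of (map ab_gen u @ ab_class h # []) -
        (\<Sum>i<n. frag_cmul (magnus h [i]) (frag_of (map ab_gen u @ ab_gen i # []))) \<in> tensor_relations ab (Suc k)"
    if "u \<in> index_words k" for u
    using tensor_expand[OF assms(3), of "[]" "map ab_gen u"] tensor_expand[OF assms(3), of "map ab_gen u" "[]"]
      map_ab_gen_closed[of u] that by auto
  show ?thesis
    unfolding eq
    by (rule tensor_relations_diff[OF group_ab])
      (rule tensor_relations_sum[OF group_ab], rule tensor_relations_cmul[OF group_ab], erule terms)+
qed

lemma magnus_tensor_carrier: "Poly_Mapping.keys (magnus_tensor k g) \<subseteq> tensor_tuples ab k"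
proof -
  have "Poly_Mapping.keys (magnus_tensor k g) \<subseteq>
      (\<Union>w\<in>index_words k. Poly_Mapping.keys (frag_cmul (magnus g w) (frag_of (map ab_gen w))))"
    unfolding magnus_tensor_def by (rule keys_sum)
  also have "\<dots> \<subseteq> tensor_tuples ab k"
    using map_ab_gen_closed keys_cmul by (fastforce simp: tensor_tuples_def)
  finally show ?thesis .
qed

lemma magnus_tensor_mult:
  assumes "1 \<le> k" "g \<in> lower_central (free_group n) k" "h \<in> lower_central (free_group n) k"
  shows "magnus_tensor k (g \<otimes>\<^bsub>free_group n\<^esub> h) = magnus_tensor k g + magnus_tensor k h"
  unfolding magnus_tensor_def sum.distrib[symmetric]
  by (rule sum.cong) (use assms in \<open>simp_all add: lower_central_magnus_add frag_cmul_distrib\<close>)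

lemma magnus_tensor_inv:
  assumes "1 \<le> k" "g \<in> lower_central (free_group n) k"
  shows "magnus_tensor k (inv\<^bsub>free_group n\<^esub> g) = - magnus_tensor k g"
  unfolding magnus_tensor_def sum_negf[symmetric]
  by (rule sum.cong) (use assms in \<open>simp_all add: lower_central_magnus_inv\<close>)

lemma magnus_tensor_lower_central_Suc:
  assumes "1 \<le> k" "g \<in> lower_central (free_group n) (Suc k)"
  shows "magnus_tensor k g = 0"
  unfolding magnus_tensor_def
  by (rule sum.neutral) (use assms in \<open>simp add: lower_central_Suc_magnus\<close>)

text \<open>The coordinate functional of the word \<open>v\<close> on the tensor power reads off \<open>magnus g v\<close>.\<close>

lemma magnus_tensor_in_relations:
  assumes "magnus_tensor k g \<in> tensor_relations ab k" and v: "v \<in> index_words k"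
  shows "magnus g v = 0"
proof -
  \<comment> \<open>The \<open>i\<close>-th coordinate of a coset, read off a chosen representative;
    any choice gives the same value because linear coefficients vanish on \<gamma>_2.\<close>
  define e where "e = (\<lambda>i C. magnus (SOME g. g \<in> carrier (free_group n) \<and> ab_class g = C) [i])"
  have e_class: "e i (ab_class g) = magnus g [i]" if g: "g \<in> carrier (free_group n)" for i g
  proof -
    define h where "h = (SOME h. h \<in> carrier (free_group n) \<and> ab_class h = ab_class g)"
    have h: "h \<in> carrier (free_group n) \<and> ab_class h = ab_class g"
      unfolding h_def by (rule someI[of _ g]) (simp add: g)
    then have "h \<in> lower_central (free_group n) 2 #>\<^bsub>free_group n\<^esub> g"
      using F.rcos_self[of h, OF _ N.subgroup_axioms] by (simp add: ab_class_def)
    then obtain z where z: "z \<in> lower_central (free_group n) (Suc 1)" "h = z \<otimes>\<^bsub>free_group n\<^esub> g"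
      by (auto simp: r_coset_def numeral_2_eq_2)
    moreover from z(1) have "z \<in> carrier (free_group n)"
      by (rule F.lower_central_closed)
    ultimately have "magnus h [i] = magnus g [i]"
      using magnus_length_1[of z g i] lower_central_Suc_magnus[of 1 z n "[i]"] g by simp
    then show ?thesis
      by (simp add: e_def h_def)
  qed
  have e_mult: "e i (x \<otimes>\<^bsub>ab\<^esub> y) = e i x + e i y" if "x \<in> carrier ab" "y \<in> carrier ab" for i x y
    using that by (auto simp: carrier_ab e_class magnus_length_1 simp flip: ab_class_mult)
  \<comment> \<open>The product of the coordinates prescribed by the letters of \<open>v\<close>: a
    multilinear form that is 1 on the tensor of \<open>v\<close> and 0 on those of other
    words.\<close>
  define m where "m = (\<lambda>xs. prod_list (map2 e v xs))"
  \<comment> \<open>The free Abelian group on one point plays the integers, so that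
    \<open>frag_extend\<close> is the linear extension of \<open>m\<close>.\<close>
  let ?f = "\<lambda>xs. frag_cmul (m xs) (frag_of ())"
  have rel: "frag_extend ?f ` tensor_relators ab k \<subseteq> {0}"
  proof clarify
    fix r assume "r \<in> tensor_relators ab k"
    then obtain us x y vs where xy: "us @ x # vs \<in> tensor_tuples ab k" "y \<in> carrier ab"
      and r: "r = frag_of (us @ (x \<otimes>\<^bsub>ab\<^esub> y) # vs) - frag_of (us @ x # vs) - frag_of (us @ y # vs)"
      unfolding tensor_relators_def by blast
    have "length us < length v"
      using xy(1) v by (auto simp: tensor_tuples_def)
    then obtain i v' where "drop (length us) v = i # v'"
      by (metis Cons_nth_drop_Suc)
    then have m: "m (us @ z # vs) = prod_list (map2 e (take (length us) v) us) * (e i z * prod_list (map2 e v' vs))" for z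
      by (simp add: m_def zip_append2)
    have "m (us @ (x \<otimes>\<^bsub>ab\<^esub> y) # vs) = m (us @ x # vs) + m (us @ y # vs)"
      using xy unfolding m by (simp add: e_mult tensor_tuples_def distrib_left distrib_right)
    then show "frag_extend ?f r = 0"
      by (simp add: r frag_extend_diff frag_cmul_distrib)
  qed
  have m_gen: "m (map ab_gen w) = (if w = v then 1 else 0)" if "w \<in> index_words k" for w
  proof -
    have "length v = length w"
      using v that by simp
    then have "set w \<subseteq> {..<n} \<Longrightarrow> prod_list (map2 e v (map ab_gen w)) = (if w = v then 1 else 0)"
      by (induction v w rule: list_induct2) (auto simp: e_class free_gen_closed magnus_free_gen)
    then show ?thesis
      using that by (simp add: m_def)
  qed
  have "frag_extend ?f (magnus_tensor k g) \<in> {0}"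
    by (rule frag_extend_tensor_relations[OF group_ab assms(1) rel]) auto
  moreover have "frag_extend ?f (magnus_tensor k g) =
      (\<Sum>w\<in>index_words k. if w = v then frag_cmul (magnus g v) (frag_of ()) else 0)"
    unfolding magnus_tensor_def frag_extend_sum[OF finite_index_words] o_def frag_extend_cmul frag_extend_of
    by (rule sum.cong) (simp_all add: m_gen)
  moreover have "\<dots> = frag_cmul (magnus g v) (frag_of ())"
    using v by (simp add: sum.delta)
  ultimately show ?thesis
    by simp
qed

section \<open>Equivariance under an automorphism\<close>

context
  fixes \<phi> :: "letter list \<Rightarrow> letter list"
  assumes \<phi>: "\<phi> \<in> auto (free_group n)"
begin

abbreviation "ab_map \<equiv> abelianization_map (free_group n) \<phi>"
abbreviation "tensor_ab_map \<equiv> frag_extend (\<lambda>xs. frag_of (map ab_map xs))"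

lemma phi_iso: "\<phi> \<in> iso (free_group n) (free_group n)"
  using \<phi> by (auto simp: auto_def Bij_def iso_def)

interpretation phi: group_hom "free_group n" "free_group n" \<phi>
  using phi_iso by unfold_locales (auto simp: iso_def)

lemma ab_map_class: "g \<in> carrier (free_group n) \<Longrightarrow> ab_map (ab_class g) = ab_class (\<phi> g)"
  unfolding abelianization_map_def ab_class_def
  by (rule quotient_map_coset[OF phi_iso N.normal_axioms F.iso_lower_central[OF phi_iso]])

lemma ab_map_iso: "ab_map \<in> iso ab ab"
  using F.abelianization_map_auto[OF \<phi>] by (auto simp: auto_def Bij_def iso_def)

lemma tensor_ab_map_relations:
  "r \<in> tensor_relations ab k \<Longrightarrow> tensor_ab_map r \<in> tensor_relations ab k"
  using frag_extend_map_iso(2)[OF group_ab ab_map_iso] by blast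

lemma tensor_ab_map_append:
  "tensor_ab_map (append_tensor us vs c) = append_tensor (map ab_map us) (map ab_map vs) (tensor_ab_map c)"
proof -
  have "frag_extend (\<lambda>xs. frag_of (map ab_map xs)) (frag_extend (frag_of \<circ> (\<lambda>xs. us @ xs @ vs)) c) =
      frag_extend (\<lambda>xs. frag_of (map ab_map us @ xs @ map ab_map vs)) (frag_extend (frag_of \<circ> map ab_map) c)"
    unfolding frag_extend_compose by (simp add: o_def)
  then show ?thesis
    by (simp add: append_tensor_def o_def)
qed

lemma append_tensor_diff: "append_tensor us vs (c - d) = append_tensor us vs c - append_tensor us vs d"
  by (simp add: append_tensor_def frag_extend_diff)

text \<open>Both sides of the equivariance satisfy the recursion of \<open>magnus_tensor_commutator\<close>.\<close>

lemma magnus_tensor_equivariant: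
  "1 \<le> k \<Longrightarrow> g \<in> lower_central (free_group n) k \<Longrightarrow>
    magnus_tensor k (\<phi> g) - tensor_ab_map (magnus_tensor k g) \<in> tensor_relations ab k"
proof (induction k arbitrary: g rule: nat_induct_at_least)
  case base
  have 1: "frag_of [ab_class h] - magnus_tensor 1 h \<in> tensor_relations ab 1"
    if "h \<in> carrier (free_group n)" for h
  proof -
    have "index_words 0 = {[]}"
      by auto
    then have "magnus_tensor 1 h = (\<Sum>i<n. frag_cmul (magnus h [i]) (frag_of [ab_gen i]))"
      unfolding magnus_tensor_def One_nat_def index_words_Suc_append by (simp only:) simp
    then show ?thesis
      using tensor_expand[OF that, of "[]" "[]"] by simp
  qed
  have g: "g \<in> carrier (free_group n)"
    using base by simp
  \<comment> \<open>\<open>tensor_ab_map\<close> sends the class of \<open>g\<close> to that of its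
    image under \<phi>, so these two terms cancel and the degree-1 defect remains.\<close>
  have "tensor_ab_map (frag_of [ab_class g] - magnus_tensor 1 g) -
      (frag_of [ab_class (\<phi> g)] - magnus_tensor 1 (\<phi> g)) \<in> tensor_relations ab 1"
    using g by (intro tensor_relations_diff[OF group_ab] tensor_ab_map_relations 1) auto
  then show ?case
    using g by (simp add: frag_extend_diff ab_map_class)
next
  case (Suc k)
  define E where "E = (\<lambda>k g. magnus_tensor k (\<phi> g) - tensor_ab_map (magnus_tensor k g))"
  let ?R = "tensor_relations ab (Suc k)"
  have phi_lc: "\<phi> g \<in> lower_central (free_group n) k" if "g \<in> lower_central (free_group n) k" for g k
    using F.iso_lower_central[OF phi_iso] that by blast
  let ?Z = "{g \<in> lower_central (free_group n) (Suc k). E (Suc k) g \<in> ?R}"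
  interpret S: normal "lower_central (free_group n) (Suc k)" "free_group n"
    by (rule F.lower_central_normal)
  have E_mult: "E (Suc k) (g \<otimes>\<^bsub>free_group n\<^esub> h) = E (Suc k) g + E (Suc k) h"
    if "g \<in> lower_central (free_group n) (Suc k)" "h \<in> lower_central (free_group n) (Suc k)" for g h
    using that phi_lc[OF that(1)] phi_lc[OF that(2)]
    by (simp add: E_def magnus_tensor_mult frag_extend_add)
  have E_inv: "E (Suc k) (inv\<^bsub>free_group n\<^esub> g) = - E (Suc k) g"
    if "g \<in> lower_central (free_group n) (Suc k)" for g
    using that phi_lc[OF that] by (simp add: E_def magnus_tensor_inv frag_extend_minus)
  \<comment> \<open>\<open>E\<close> is exactly additive on \<gamma>_(k+1), so it suffices to treat
    the commutators that generate this subgroup.\<close>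
  have sub: "subgroup ?Z (free_group n)"
  proof (rule F.subgroupI)
    have "E (Suc k) \<one>\<^bsub>free_group n\<^esub> = 0"
      using E_mult[of "\<one>\<^bsub>free_group n\<^esub>" "\<one>\<^bsub>free_group n\<^esub>"] subgroup.one_closed[OF S.subgroup_axioms] by simp
    then have "\<one>\<^bsub>free_group n\<^esub> \<in> ?Z"
      using subgroup.one_closed[OF S.subgroup_axioms] tensor_relations_zero[OF group_ab] by (metis (mono_tags, lifting) mem_Collect_eq)
    then show "?Z \<noteq> {}"
      by blast
  qed (auto simp: E_mult E_inv tensor_relations_add[OF group_ab] tensor_relations_minus[OF group_ab]
      subgroup.m_closed[OF S.subgroup_axioms] subgroup.m_inv_closed[OF S.subgroup_axioms])
  have comm: "E (Suc k) (commutator (free_group n) g h) \<in> ?R"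
    if g: "g \<in> lower_central (free_group n) k" and h: "h \<in> carrier (free_group n)" for g h
  proof -
    define B where "B = (\<lambda>(a :: letter list set) c. append_tensor [] [a] c - append_tensor [a] [] c)"
    have B_closed: "B a r \<in> ?R" if "a \<in> carrier ab" "r \<in> tensor_relations ab k" for a r
      unfolding B_def
      using append_tensor_relations[OF group_ab that(2), of "[]" "[a]"]
        append_tensor_relations[OF group_ab that(2), of "[a]" "[]"] that(1)
      by (intro tensor_relations_diff[OF group_ab]) simp_all
    have gc: "g \<in> carrier (free_group n)"
      using g by simp
    have "\<phi> (commutator (free_group n) g h) = commutator (free_group n) (\<phi> g) (\<phi> h)"
      using gc h by (simp add: commutator_def)
    moreover have "magnus_tensor (Suc k) (commutator (free_group n) (\<phi> g) (\<phi> h)) -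
        B (ab_class (\<phi> h)) (magnus_tensor k (\<phi> g)) \<in> ?R"
      unfolding B_def using h by (intro magnus_tensor_commutator Suc.hyps phi_lc g) auto
    moreover have "B (ab_class (\<phi> h)) (E k g) \<in> ?R"
      unfolding E_def using h by (intro B_closed Suc.IH g) auto
    moreover have "tensor_ab_map (magnus_tensor (Suc k) (commutator (free_group n) g h) -
        B (ab_class h) (magnus_tensor k g)) \<in> ?R"
      unfolding B_def by (intro tensor_ab_map_relations magnus_tensor_commutator Suc.hyps g h)
    moreover have "tensor_ab_map (B (ab_class h) (magnus_tensor k g)) =
        B (ab_class (\<phi> h)) (tensor_ab_map (magnus_tensor k g))"
      unfolding B_def by (simp add: frag_extend_diff tensor_ab_map_append ab_map_class[OF h])
    moreover have "B (ab_class (\<phi> h)) (E k g) =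
        B (ab_class (\<phi> h)) (magnus_tensor k (\<phi> g)) - B (ab_class (\<phi> h)) (tensor_ab_map (magnus_tensor k g))"
      by (simp add: B_def E_def append_tensor_diff)
    \<comment> \<open>Three relations add up to the defect: the bracket rule for the images under
      \<phi>, the bracket with the defect in degree \<open>k\<close>, and minus the image of the
      bracket rule for \<open>g\<close> and \<open>h\<close>.\<close>
    moreover have "E (Suc k) (commutator (free_group n) g h) =
        (magnus_tensor (Suc k) (\<phi> (commutator (free_group n) g h)) - B (ab_class (\<phi> h)) (magnus_tensor k (\<phi> g))) +
        B (ab_class (\<phi> h)) (E k g) -
        tensor_ab_map (magnus_tensor (Suc k) (commutator (free_group n) g h) - B (ab_class h) (magnus_tensor k g))"
      using calculation(5,6) by (simp add: E_def frag_extend_diff)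
    ultimately show ?thesis
      using tensor_relations_diff[OF group_ab tensor_relations_add[OF group_ab]] by metis
  qed
  have "lower_central (free_group n) (Suc k) \<subseteq> ?Z"
    unfolding F.lower_central_Suc[OF Suc.hyps]
  proof (rule F.generate_subgroup_incl)
    show "(\<Union>x\<in>lower_central (free_group n) k. \<Union>y\<in>carrier (free_group n).
        {commutator (free_group n) x y}) \<subseteq>
      {g \<in> generate (free_group n) (\<Union>x\<in>lower_central (free_group n) k. \<Union>y\<in>carrier (free_group n).
        {commutator (free_group n) x y}). E (Suc k) g \<in> ?R}"
      using comm by (auto intro: generate.incl)
  qed (use sub F.lower_central_Suc[OF Suc.hyps] in simp)
  then show ?case
    using Suc.prems unfolding E_def by blast
qed

end

end

text \<open>The class of \<open>magnus_tensor\<close> depends only on the coset, as \<gamma>_(k+1)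
  has no terms of degree \<open>k\<close>. If it is trivial,
  \<open>magnus_tensor_in_relations\<close> makes all degree-\<open>k\<close> coefficients vanish
  and \<open>lower_central_magnus_kernel\<close> applies. Equivariance is
  \<open>magnus_tensor_equivariant\<close> read in the quotient.\<close>

lemma lower_central_factor_embedding:
  assumes \<phi>: "\<phi> \<in> auto (free_group n)" and k: "1 \<le> k"
  obtains \<iota> where "\<iota> \<in> hom (lower_central_factor (free_group n) k) (tensor_power (abelianization (free_group n)) k)"
    "inj_on \<iota> (carrier (lower_central_factor (free_group n) k))"
    "\<And>C. C \<in> carrier (lower_central_factor (free_group n) k) \<Longrightarrow>
      \<iota> (lower_central_factor_map (free_group n) k \<phi> C) =
      tensor_power_map (abelianization (free_group n)) k (abelianization_map (free_group n) \<phi>) (\<iota> C)"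
proof -
  interpret F: group "free_group n"
    by (rule group_free_group)
  define A where "A = abelianization (free_group n)"
  define N where "N = lower_central (free_group n) (Suc k)"
  define L where "L = (free_group n)\<lparr>carrier := lower_central (free_group n) k\<rparr>"
  define T where "T = free_Abelian_group (tensor_tuples A k)"
  define R where "R = tensor_relations A k"
  define \<theta> where "\<theta> = (\<lambda>g. R #>\<^bsub>T\<^esub> magnus_tensor n k g)"
  have A: "group A"
    unfolding A_def by (rule group_ab)
  interpret R: normal R T
    unfolding R_def T_def by (rule tensor_relations_normal[OF A])
  interpret N: normal N L
    unfolding N_def L_def by (rule F.lower_central_Suc_normal)
  have factor: "lower_central_factor (free_group n) k = L Mod N"
    and power: "tensor_power A k = T Mod R"
    by (simp_all add: lower_central_factor_def L_def N_def tensor_power_def T_def R_def)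
  have L: "g \<in> carrier L \<longleftrightarrow> g \<in> lower_central (free_group n) k" for g
    by (simp add: L_def)
  have mt_closed: "magnus_tensor n k g \<in> carrier T" for g
    using magnus_tensor_carrier by (simp add: T_def A_def)
  have "magnus_tensor n k \<in> hom L T"
    using mt_closed k by (intro homI) (simp_all add: L magnus_tensor_mult, simp_all add: L_def T_def magnus_tensor_mult)
  then have \<theta>_hom: "\<theta> \<in> hom L (T Mod R)"
    using hom_compose[OF _ R.r_coset_hom_Mod] by (simp add: \<theta>_def o_def)
  interpret \<theta>: group_hom L "T Mod R" \<theta>
    by (intro group_hom.intro group_hom_axioms.intro \<theta>_hom R.factorgroup_is_group N.is_group)
  \<comment> \<open>The bridge from congruences of representatives modulo \<open>R\<close> to
    equalities in the tensor power.\<close>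
  have \<theta>_eq_iff: "\<theta> g = \<theta>' \<longleftrightarrow> magnus_tensor n k g - c \<in> R" if "c \<in> carrier T" "\<theta>' = R #>\<^bsub>T\<^esub> c" for g \<theta>' c
  proof -
    have "\<theta> g = \<theta>' \<longleftrightarrow> magnus_tensor n k g \<otimes>\<^bsub>T\<^esub> inv\<^bsub>T\<^esub> c \<in> R"
      unfolding \<theta>_def that(2)
      by (metis R.rcos_self R.repr_independence R.rcos_module R.subgroup_axioms R.is_group mt_closed that(1))
    then show ?thesis
      using that(1) by (simp add: T_def)
  qed
  have \<theta>_one: "\<theta> g = R \<longleftrightarrow> magnus_tensor n k g \<in> R" for g
    using \<theta>_eq_iff[of 0 R g] R.coset_mult_one[OF R.subset] by (simp add: T_def)
  have "N \<subseteq> kernel L (T Mod R) \<theta>"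
  proof
    fix g assume g: "g \<in> N"
    then have "magnus_tensor n k g = 0"
      unfolding N_def by (rule magnus_tensor_lower_central_Suc[OF k])
    then have "\<theta> g = R"
      using tensor_relations_zero[OF A, of k, folded R_def] by (simp add: \<theta>_one)
    then show "g \<in> kernel L (T Mod R) \<theta>"
      using N.subset g by (auto simp: kernel_def)
  qed
  then obtain \<iota> where \<iota>: "\<iota> \<in> hom (L Mod N) (T Mod R)" "\<And>g. g \<in> carrier L \<Longrightarrow> \<iota> (N #>\<^bsub>L\<^esub> g) = \<theta> g"
    using \<theta>.FactGroup_universal_kernel[OF N.normal_axioms] by blast
  interpret \<iota>: group_hom "L Mod N" "T Mod R" \<iota>
    by (intro group_hom.intro group_hom_axioms.intro \<iota> R.factorgroup_is_group N.factorgroup_is_group)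
  have "inj_on \<iota> (carrier (L Mod N))"
    unfolding \<iota>.inj_on_one_iff
  proof (intro allI impI)
    fix C assume C: "C \<in> carrier (L Mod N)" "\<iota> C = \<one>\<^bsub>T Mod R\<^esub>"
    then obtain g where g: "g \<in> carrier L" "C = N #>\<^bsub>L\<^esub> g"
      by (auto simp: carrier_FactGroup)
    have "magnus_tensor n k g \<in> tensor_relations (abelianization (free_group n)) k"
      using \<theta>_one[of g] C(2) \<iota>(2)[OF g(1)] g(2) by (simp add: R_def A_def)
    then have "g \<in> N"
      unfolding N_def using magnus_tensor_in_relations g(1) L
      by (intro lower_central_magnus_kernel[OF k]) auto
    then show "C = \<one>\<^bsub>L Mod N\<^esub>"
      using g N.rcos_const[OF N.is_group] by simp
  qed
  moreover have "\<iota> (lower_central_factor_map (free_group n) k \<phi> C) =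
      tensor_power_map A k (abelianization_map (free_group n) \<phi>) (\<iota> C)"
    if C: "C \<in> carrier (L Mod N)" for C
  proof -
    obtain g where g: "g \<in> carrier L" "C = N #>\<^bsub>L\<^esub> g"
      using C by (auto simp: carrier_FactGroup)
    note f = phi_iso[OF \<phi>]
    note ab_iso = ab_map_iso[OF \<phi>, folded A_def]
    have "\<phi> \<in> iso L L"
      using f F.lower_central_subset[of k] F.iso_lower_central[OF f, of k]
      by (auto simp: L_def iso_def hom_def bij_betw_def subset_iff intro: inj_on_subset)
    moreover have "\<phi> ` N = N"
      unfolding N_def by (rule F.iso_lower_central[OF f])
    ultimately have "lower_central_factor_map (free_group n) k \<phi> C = N #>\<^bsub>L\<^esub> \<phi> g"
      unfolding lower_central_factor_map_def g(2)
      using quotient_map_coset[OF _ N.normal_axioms _ g(1)] by (simp add: L_def N_def)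
    moreover have \<phi>g: "\<phi> g \<in> carrier L"
      using F.iso_lower_central[OF f, of k] g(1) unfolding L by blast
    moreover have "tensor_power_map A k (abelianization_map (free_group n) \<phi>) (\<theta> g) =
        R #>\<^bsub>T\<^esub> frag_extend (\<lambda>xs. frag_of (map (abelianization_map (free_group n) \<phi>) xs)) (magnus_tensor n k g)"
      (is "_ = R #>\<^bsub>T\<^esub> ?c")
      unfolding tensor_power_map_def \<theta>_def R_def T_def
      by (intro quotient_map_coset frag_extend_map_iso A ab_iso tensor_relations_normal)
        (use mt_closed T_def in blast)
    moreover have "\<theta> (\<phi> g) = R #>\<^bsub>T\<^esub> ?c"
    proof (subst \<theta>_eq_iff[OF _ refl])
      show "?c \<in> carrier T"
        using frag_extend_map_iso(1)[OF A ab_iso, of k] mt_closed[of g] by (auto simp: iso_def hom_def T_def simp del: carrier_free_Abelian_group_iff)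
      show "magnus_tensor n k (\<phi> g) - ?c \<in> R"
        using magnus_tensor_equivariant[OF \<phi> k] g(1) unfolding R_def A_def L by blast
    qed
    ultimately show ?thesis
      using \<iota>(2) g by simp
  qed
  ultimately show thesis
    using that[of \<iota>] \<iota>(1) unfolding factor by (simp add: A_def[symmetric] power)
qed


section \<open>Passing to the semidirect products\<close>

text \<open>The multiplication of \<open>semidirect_int\<close> involves all integer powers, while
  equivariance is given for the automorphisms themselves.\<close>

lemma auto_int_pow_equivariant:
  assumes "group M" "group M'" "\<psi> \<in> auto M" "\<psi>' \<in> auto M'" and \<iota>: "\<iota> \<in> hom M M'"
    and eq: "\<And>a. a \<in> carrier M \<Longrightarrow> \<iota> (\<psi> a) = \<psi>' (\<iota> a)" and a: "a \<in> carrier M"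
  shows "\<iota> ((\<psi> [^]\<^bsub>AutoGroup M\<^esub> (j :: int)) a) = (\<psi>' [^]\<^bsub>AutoGroup M'\<^esub> j) (\<iota> a)"
proof -
  interpret Aut: group "AutoGroup M"
    by (rule group.AutoGroup) fact
  interpret Aut': group "AutoGroup M'"
    by (rule group.AutoGroup) fact
  have closed: "f x \<in> carrier K" if "f \<in> carrier (AutoGroup K)" "x \<in> carrier K"
    for f x and K :: "('x, 'y) monoid_scheme"
    using that by (auto simp: AutoGroup_def auto_def hom_def)
  have mult: "(f \<otimes>\<^bsub>AutoGroup K\<^esub> g) x = f (g x)"
    if "f \<in> carrier (AutoGroup K)" "g \<in> carrier (AutoGroup K)" "x \<in> carrier K"
    for f g x and K :: "('x, 'y) monoid_scheme"
    using that by (simp add: AutoGroup_def BijGroup_def auto_def compose_def)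
  have one: "\<one>\<^bsub>AutoGroup K\<^esub> x = x" if "x \<in> carrier K" for x and K :: "('x, 'y) monoid_scheme"
    using that by (simp add: AutoGroup_def BijGroup_def)
  have \<psi>: "\<psi> \<in> carrier (AutoGroup M)" "\<psi>' \<in> carrier (AutoGroup M')"
    using assms(3,4) by (simp_all add: AutoGroup_def)
  have \<iota>_closed: "\<iota> x \<in> carrier M'" if "x \<in> carrier M" for x
    using hom_in_carrier[OF \<iota> that] .
  have nat: "\<iota> ((\<psi> [^]\<^bsub>AutoGroup M\<^esub> m) a) = (\<psi>' [^]\<^bsub>AutoGroup M'\<^esub> m) (\<iota> a)"
    if "a \<in> carrier M" for m :: nat and a
    using that
  proof (induction m arbitrary: a)
    case 0
    then show ?case
      by (simp add: one \<iota>_closed)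
  next
    case (Suc m)
    then show ?case
      using \<psi> by (simp add: mult \<iota>_closed closed eq)
  qed
  show ?thesis
  proof (cases j rule: int_cases2)
    case (nonneg m)
    then show ?thesis
      using nat[OF a] by (simp add: int_pow_int)
  next
    case (nonpos m)
    let ?f = "\<psi> [^]\<^bsub>AutoGroup M\<^esub> m" and ?f' = "\<psi>' [^]\<^bsub>AutoGroup M'\<^esub> m"
    have f: "?f \<in> carrier (AutoGroup M)" "?f' \<in> carrier (AutoGroup M')"
      using \<psi> by simp_all
    \<comment> \<open>A negative power is handled by applying the statement for the positive power
      to the preimage of \<open>a\<close>.\<close>
    define b where "b = (inv\<^bsub>AutoGroup M\<^esub> ?f) a"
    have b: "b \<in> carrier M"
      unfolding b_def by (rule closed) (use f a in simp_all)
    have "?f b = a"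
      unfolding b_def using mult[OF f(1) Aut.inv_closed[OF f(1)] a] Aut.r_inv[OF f(1)] one[OF a] by simp
    then have "\<iota> a = ?f' (\<iota> b)"
      using nat[OF b, of m] by metis
    then have "(inv\<^bsub>AutoGroup M'\<^esub> ?f') (\<iota> a) = \<iota> b"
      using mult[OF Aut'.inv_closed[OF f(2)] f(2) \<iota>_closed[OF b]] Aut'.l_inv[OF f(2)] one[OF \<iota>_closed[OF b]]
      by simp
    then show ?thesis
      using nonpos \<psi> by (simp add: Aut.int_pow_neg Aut'.int_pow_neg int_pow_int b_def)
  qed
qed

lemma semidirect_int_embedding:
  assumes "group M" "group M'" "\<psi> \<in> auto M" "\<psi>' \<in> auto M'" "\<iota> \<in> hom M M'" "inj_on \<iota> (carrier M)"
    and "\<And>a. a \<in> carrier M \<Longrightarrow> \<iota> (\<psi> a) = \<psi>' (\<iota> a)"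
  shows "map_prod \<iota> id \<in> hom (semidirect_int M \<psi>) (semidirect_int M' \<psi>')"
    and "inj_on (map_prod \<iota> id) (carrier (semidirect_int M \<psi>))"
proof -
  have closed: "(\<psi> [^]\<^bsub>AutoGroup M\<^esub> (j :: int)) a \<in> carrier M" if "a \<in> carrier M" for j a
  proof -
    interpret Aut: group "AutoGroup M"
      by (rule group.AutoGroup) fact
    have "\<psi> [^]\<^bsub>AutoGroup M\<^esub> j \<in> carrier (AutoGroup M)"
      using assms(3) by (intro Aut.int_pow_closed) (simp add: AutoGroup_def)
    then show ?thesis
      using that by (auto simp: AutoGroup_def auto_def hom_def)
  qed
  show "map_prod \<iota> id \<in> hom (semidirect_int M \<psi>) (semidirect_int M' \<psi>')"
    using hom_in_carrier[OF assms(5)] closed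
    by (intro homI)
      (auto simp: semidirect_int_def hom_mult[OF assms(5)] auto_int_pow_equivariant[OF assms(1-5,7)])
  show "inj_on (map_prod \<iota> id) (carrier (semidirect_int M \<psi>))"
    using assms(6) by (auto simp: semidirect_int_def inj_on_def)
qed

text \<open>Separating homomorphisms are restricted along \<open>f\<close>. Their targets live on
  sets over the type of \<open>G\<close>; \<open>residually_nilpotentI\<close> moves them to sets
  over the type of \<open>K\<close>.\<close>

lemma residually_nilpotent_mon:
  fixes G :: "('c, 'd) monoid_scheme"
  assumes "group K" "group G" "residually_nilpotent G" "f \<in> hom K G" "inj_on f (carrier K)"
  shows "residually_nilpotent K"
proof (rule residually_nilpotentI[OF assms(1)])
  interpret f: group_hom K G f
    using assms by (simp add: group_hom_def group_hom_axioms_def)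
  fix x assume x: "x \<in> carrier K" "x \<noteq> \<one>\<^bsub>K\<^esub>"
  then have "f x \<noteq> \<one>\<^bsub>G\<^esub>"
    using assms(5) f.inj_on_one_iff by blast
  then obtain H :: "'c set monoid" and h where "nilpotent_group H" "h \<in> hom G H" "h (f x) \<noteq> \<one>\<^bsub>H\<^esub>"
    using assms(3) f.hom_closed[OF x(1)] unfolding residually_nilpotent_def by blast
  then show "\<exists>(H :: 'c set monoid) h. nilpotent_group H \<and> h \<in> hom K H \<and> h x \<noteq> \<one>\<^bsub>H\<^esub>"
    using hom_compose[OF assms(4)] by (metis comp_apply)
qed

lemma residually_p_finite_mon:
  fixes G :: "('c, 'd) monoid_scheme"
  assumes "prime p" "group K" "group G" "residually_p_finite p G" "f \<in> hom K G" "inj_on f (carrier K)"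
  shows "residually_p_finite p K"
proof (rule residually_p_finiteI[OF assms(1,2)])
  interpret f: group_hom K G f
    using assms by (simp add: group_hom_def group_hom_axioms_def)
  fix x assume x: "x \<in> carrier K" "x \<noteq> \<one>\<^bsub>K\<^esub>"
  then have "f x \<noteq> \<one>\<^bsub>G\<^esub>"
    using assms(6) f.inj_on_one_iff by blast
  then obtain H :: "'c set monoid" and h where "finite_p_group p H" "h \<in> hom G H" "h (f x) \<noteq> \<one>\<^bsub>H\<^esub>"
    using assms(4) f.hom_closed[OF x(1)] unfolding residually_p_finite_def by blast
  then show "\<exists>(H :: 'c set monoid) h. finite_p_group p H \<and> h \<in> hom K H \<and> h x \<noteq> \<one>\<^bsub>H\<^esub>"
    using hom_compose[OF assms(5)] by (metis comp_apply)
qed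

theorem corollary1:
  fixes n p k :: nat and \<phi> :: "letter list \<Rightarrow> letter list"
  assumes "\<phi> \<in> auto (free_group n)" and "prime p" and "k \<ge> 1"
  shows "(residually_nilpotent (G_bar (free_group n) \<phi> k) \<longrightarrow>
            residually_nilpotent (G_hat (free_group n) \<phi> k)) \<and>
         (residually_p_finite p (G_bar (free_group n) \<phi> k) \<longrightarrow>
            residually_p_finite p (G_hat (free_group n) \<phi> k))"
proof -
  interpret F: group "free_group n"
    by (rule group_free_group)
  obtain \<iota> where \<iota>: "\<iota> \<in> hom (lower_central_factor (free_group n) k) (tensor_power (abelianization (free_group n)) k)"
    "inj_on \<iota> (carrier (lower_central_factor (free_group n) k))"
    "\<And>C. C \<in> carrier (lower_central_factor (free_group n) k) \<Longrightarrow>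
      \<iota> (lower_central_factor_map (free_group n) k \<phi> C) =
      tensor_power_map (abelianization (free_group n)) k (abelianization_map (free_group n) \<phi>) (\<iota> C)"
    using lower_central_factor_embedding[OF assms(1,3)] by metis
  have "group (lower_central_factor (free_group n) k)"
    unfolding lower_central_factor_def by (rule normal.factorgroup_is_group[OF F.lower_central_Suc_normal])
  moreover have "group (tensor_power (abelianization (free_group n)) k)"
    by (rule comm_group.axioms(2)[OF comm_group_tensor_power[OF group_ab]])
  moreover have "tensor_power_map (abelianization (free_group n)) k (abelianization_map (free_group n) \<phi>)
      \<in> auto (tensor_power (abelianization (free_group n)) k)"
    by (rule tensor_power_map_auto[OF group_ab ab_map_iso[OF assms(1)]])
  ultimately have emb: "map_prod \<iota> id \<in> hom (G_hat (free_group n) \<phi> k) (G_bar (free_group n) \<phi> k)"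
    "inj_on (map_prod \<iota> id) (carrier (G_hat (free_group n) \<phi> k))"
    unfolding G_hat_def G_bar_def
    using semidirect_int_embedding[OF _ _ F.lower_central_factor_map_auto[OF assms(1)] _ \<iota>] by blast+
  show ?thesis
    using residually_nilpotent_mon[OF F.group_G_hat F.group_G_bar _ emb]
      residually_p_finite_mon[OF assms(2) F.group_G_hat F.group_G_bar _ emb] assms(1) by blast
qed

end
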